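(* Let $f,g_1,\dots,g_m\in\operatorname{Sym}\mathbb R\langle\mathbf q,\bar{\mathbf q}\rangle$ and $h_1,\dots,h_\ell\in\mathbb R\langle\mathbf q,\bar{\mathbf q}\rangle$. Assume that $\mathcal Q^{\mathbb R}(\mathbf g,\mathbf h)$ is Archimedean. If $f>0$ on $K_{\mathbf g,\mathbf h}$, then $\widehat f\in\mathcal Q_{\mathbf h}(\mathbf g)$. Equivalently, $f\in\mathcal Q^{\mathbb R}(\mathbf g,\mathbf h)+\operatorname{Sym}\mathcal I_n^{\mathbb R}$.
   Context: $\mathbb H$ is the skew field of quaternions. Fix $n\ge1$ and letters $q_1,\dots,q_n,\bar q_1,\dots,\bar q_n$. $\mathcal W$ is the set of words (including the empty word $1$) in these letters, where words with the same normal form are identified: any consecutive factor $q_i\bar q_i$ or $\bar q_iq_i$ is written $|q_i|^2$ and moved to the front, so each word is uniquely $\prod_i|q_i|^{2\alpha_i}\tilde w$ with $\tilde w$ containing no such factor. $w^*$ is obtained by reversing $w$ and exchanging $q_i\leftrightarrow\bar q_i$. $\mathcal F_n=\mathbb R\langle\mathbf q,\bar{\mathbf q}\rangle$ is the real $*$-algebra of finite sums $\sum_wp_ww$, $p_w\in\mathbb R$, with $p^*=\sum_wp_ww^*$. $\operatorname{Sym}$ denotes the set of elements with $p=p^*$. For $\mathbf a\in\mathbb H^n$, $p(\mathbf a,\bar{\mathbf a})$ is the evaluation $q_i\mapsto a_i$, $\bar q_i\mapsto\bar a_i$; symmetric $p$ take real values. $K_{\mathbf g,\mathbf h}=\{\mathbf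 a\in\mathbb H^n: g_i(\mathbf a,\bar{\mathbf a})\ge0\ (1\le i\le m),\ h_j(\mathbf a,\bar{\mathbf a})=0\ (1\le j\le\ell)\}$. $\mathcal I_n^{\mathbb R}$ is the two-sided $*$-ideal of all $p\in\mathcal F_n$ with $p(\mathbf a,\bar{\mathbf a})=0$ for every $\mathbf a\in\mathbb H^n$. $\Sigma^{\mathbb R}$ is the set of finite sums $\sum_sp_s^*p_s$ with $p_s\in\mathcal F_n$. $\mathcal Q^{\mathbb R}(\mathbf g,\mathbf h)$ is the set of all $$\sigma_0+\tfrac12\sum_{i=1}^m(\sigma_ig_i+g_i\sigma_i)+\sum_{j=1}^\ell\sum_\alpha\left(\tau_{j\alpha}h_j\nu_{j\alpha}+\nu_{j\alpha}^*h_j^*\tau_{j\alpha}^*\right)$$ (finite sums) with $\sigma_i\in\Sigma^{\mathbb R}$ and $\tau_{j\alpha},\nu_{j\alpha}\in\mathcal F_n$. It is Archimedean if there is $R>0$ with $R-\sum_{i=1}^n|q_i|^2\in\mathcal Q^{\mathbb R}(\mathbf g,\mathbf h)$. Let $\pi:\mathcal F_n\to\mathcal A=\mathcal F_n/\mathcal I_n^{\mathbb R}$ be the quotient map, $\mathcal J$ the two-sided $*$-ideal of $\mathcal A$ generated by $\pi(h_1),\dots,\pi(h_\ell)$, $\mathcal A_{\mathbf h}=\mathcal A/\mathcal J$, $\eta:\mathcal A\to\mathcal A_{\mathbf h}$ the quotient map, and $\widehat p=\eta(\pi(p))$ for $p\in\mathcal F_n$. Then $$\mathcal Q_{\mathbf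 h}(\mathbf g)=\Big\{\sum_\alpha p_{0\alpha}^*p_{0\alpha}+\sum_{i=1}^m\sum_\alpha p_{i\alpha}^*\widehat g_ip_{i\alpha}:\ p_{i\alpha}\in\mathcal A_{\mathbf h}\Big\}$$ (finite sums). *)

theory Defs
  imports
    "HOL-Analysis.Analysis"
    "HOL-Library.Poly_Mapping"
    "HOL-Algebra.QuotRing"
begin

section \<open>Quaternions\<close>

datatype quat = Quat (qre: real) (qi: real) (qj: real) (qk: real)

lemma quat_eq_iff: "x = y \<longleftrightarrow> qre x = qre y \<and> qi x = qi y \<and> qj x = qj y \<and> qk x = qk y"
  by (cases x; cases y) auto

definition qcnj :: "quat \<Rightarrow> quat" where
  "qcnj x = Quat (qre x) (- qi x) (- qj x) (- qk x)"

lemma qcnj_simps [simp]: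
  "qre (qcnj x) = qre x" "qi (qcnj x) = - qi x" "qj (qcnj x) = - qj x" "qk (qcnj x) = - qk x"
  by (simp_all add: qcnj_def)

definition qnorm2 :: "quat \<Rightarrow> real" where
  "qnorm2 x = (qre x)\<^sup>2 + (qi x)\<^sup>2 + (qj x)\<^sup>2 + (qk x)\<^sup>2"

instantiation quat :: real_div_algebra
begin

definition "0 = Quat 0 0 0 0"
definition "1 = Quat 1 0 0 0"
definition "x + y = Quat (qre x + qre y) (qi x + qi y) (qj x + qj y) (qk x + qk y)"
definition "- x = Quat (- qre x) (- qi x) (- qj x) (- qk x)"
definition "x - y = Quat (qre x - qre y) (qi x - qi y) (qj x - qj y) (qk x - qk y)"
definition "r *\<^sub>R x = Quat (r * qre x) (r * qi x) (r * qj x) (r * qk x)"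
definition "x * y = Quat
  (qre x * qre y - qi x * qi y - qj x * qj y - qk x * qk y)
  (qre x * qi y + qi x * qre y + qj x * qk y - qk x * qj y)
  (qre x * qj y - qi x * qk y + qj x * qre y + qk x * qi y)
  (qre x * qk y + qi x * qj y - qj x * qi y + qk x * qre y)"
definition "inverse x = (1 / qnorm2 x) *\<^sub>R qcnj x"
definition "x div y = x * inverse (y :: quat)"

lemmas quat_defs = zero_quat_def one_quat_def plus_quat_def uminus_quat_def minus_quat_def
  scaleR_quat_def times_quat_def

instance
proof
  fix x :: quat
  assume "x \<noteq> 0"
  then have n0: "qnorm2 x \<noteq> 0"
    by (auto simp: qnorm2_def quat_eq_iff quat_defs add_nonneg_eq_0_iff)
  then show "x * inverse x = 1" "inverse x * x = 1"
    by (auto simp: inverse_quat_def quat_eq_iff quat_defs divide_simps)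
       (auto simp: qnorm2_def power2_eq_square algebra_simps)
qed (auto simp: quat_eq_iff quat_defs inverse_quat_def divide_quat_def qnorm2_def algebra_simps)

end

text \<open>As for complex numbers, the order only compares quaternions whose difference is real;
  \<open>0 \<le> x\<close> says that \<open>x\<close> is a nonnegative real.\<close>

instantiation quat :: order
begin

definition "x \<le> y \<longleftrightarrow> qre x \<le> qre y \<and> qi x = qi y \<and> qj x = qj y \<and> qk x = qk y"
definition "x < y \<longleftrightarrow> qre x < qre y \<and> qi x = qi y \<and> qj x = qj y \<and> qk x = qk y"

instance
  by standard (auto simp: less_eq_quat_def less_quat_def quat_eq_iff)

end

lemma qcnj_mult: "qcnj (x * y) = qcnj y * qcnj x"
  by (simp add: quat_eq_iff quat_defs algebra_simps)

lemma qcnj_add: "qcnj (x + y) = qcnj x + qcnj y"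
  by (simp add: quat_eq_iff quat_defs)

lemma qcnj_scaleR: "qcnj (r *\<^sub>R x) = r *\<^sub>R qcnj x"
  by (simp add: quat_eq_iff quat_defs)

lemma qcnj_0 [simp]: "qcnj 0 = 0"
  by (simp add: quat_eq_iff quat_defs)

lemma qcnj_1 [simp]: "qcnj 1 = 1"
  by (simp add: quat_eq_iff quat_defs)

lemma qcnj_qcnj [simp]: "qcnj (qcnj x) = x"
  by (simp add: quat_eq_iff)

lemma mult_qcnj: "x * qcnj x = of_real (qnorm2 x)" "qcnj x * x = of_real (qnorm2 x)"
  by (simp_all add: quat_eq_iff quat_defs of_real_def qnorm2_def power2_eq_square algebra_simps)

lemma of_real_quat_commute: "of_real r * x = x * (of_real r :: quat)"
  by (simp add: of_real_def)


section \<open>Words\<close>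

text \<open>\<open>Ltr i\<close> is $q_i$ and \<open>CLtr i\<close> is $\bar q_i$.\<close>

datatype 'n letter = Ltr (idx: 'n) | CLtr (idx: 'n)

primrec cletter :: "'n letter \<Rightarrow> 'n letter" where
  "cletter (Ltr i) = CLtr i"
| "cletter (CLtr i) = Ltr i"

lemma cletter_cletter [simp]: "cletter (cletter x) = x"
  by (cases x) auto

lemma idx_cletter [simp]: "idx (cletter x) = idx x"
  by (cases x) auto

text \<open>A normal form is a pair \<open>(\<alpha>, w)\<close> standing for $\prod_i |q_i|^{2\alpha_i} w$, where \<open>w\<close> has
  no factor $q_i \bar q_i$ or $\bar q_i q_i$.\<close>

fun push :: "'n letter \<Rightarrow> ('n \<Rightarrow> nat) \<times> 'n letter list \<Rightarrow> ('n \<Rightarrow> nat) \<times> 'n letter list" where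
  "push x (\<alpha>, []) = (\<alpha>, [x])"
| "push x (\<alpha>, y # w) =
     (if y = cletter x then (\<alpha>(idx x := Suc (\<alpha> (idx x))), w) else (\<alpha>, x # y # w))"

definition normal_form :: "'n letter list \<Rightarrow> ('n \<Rightarrow> nat) \<times> 'n letter list" where
  "normal_form w = foldr push w (\<lambda>_. 0, [])"

fun reduced_word :: "'n letter list \<Rightarrow> bool" where
  "reduced_word (x # y # w) \<longleftrightarrow> y \<noteq> cletter x \<and> reduced_word (y # w)"
| "reduced_word _ \<longleftrightarrow> True"

definition shift_exp :: "('n \<Rightarrow> nat) \<Rightarrow> ('n \<Rightarrow> nat) \<times> 'n letter list \<Rightarrow> ('n \<Rightarrow> nat) \<times> 'n letter list" where
  "shift_exp \<beta> p = (\<lambda>i. \<beta> i + fst p i, snd p)"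

lemma reduced_word_Cons: "reduced_word (x # w) \<Longrightarrow> reduced_word w"
  by (cases w) auto

lemma reduced_word_push: "reduced_word (snd p) \<Longrightarrow> reduced_word (snd (push x p))"
  by (induction x p rule: push.induct) (auto dest: reduced_word_Cons)

lemma reduced_word_foldr: "reduced_word (snd p) \<Longrightarrow> reduced_word (snd (foldr push u p))"
  by (induction u) (auto intro: reduced_word_push)

lemma reduced_word_normal_form: "reduced_word (snd (normal_form u))"
  by (simp add: normal_form_def reduced_word_foldr)

lemma normal_form_reduced: "reduced_word w \<Longrightarrow> normal_form w = (\<lambda>_. 0, w)"
  by (induction w rule: reduced_word.induct) (auto simp: normal_form_def)

lemma push_shift: "push x (shift_exp \<beta> p) = shift_exp \<beta> (push x p)"
  by (induction x p rule: push.induct) (auto simp: shift_exp_def)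

lemma foldr_push_shift: "foldr push u (shift_exp \<beta> p) = shift_exp \<beta> (foldr push u p)"
  by (induction u) (auto simp: push_shift)

lemma push_push:
  assumes "reduced_word (snd p)"
  shows "push x (push (cletter x) p) = shift_exp ((\<lambda>_. 0)(idx x := 1)) p"
proof (cases p)
  case (Pair \<alpha> w)
  show ?thesis
  proof (cases w)
    case Nil
    then show ?thesis using Pair by (auto simp: shift_exp_def fun_eq_iff)
  next
    case (Cons y v)
    then show ?thesis
      using Pair assms by (cases v) (auto simp: shift_exp_def fun_eq_iff)
  qed
qed

lemma foldr_push_normal_form:
  assumes "reduced_word (snd p)"
  shows "foldr push u p = shift_exp (fst (normal_form u)) (foldr push (snd (normal_form u)) p)"
proof (induction u)
  case Nil
  then show ?case by (simp add: normal_form_def shift_exp_def)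
next
  case (Cons x u)
  obtain \<alpha> w where nf: "normal_form u = (\<alpha>, w)" by fastforce
  have nf': "normal_form (x # u) = push x (\<alpha>, w)"
    using nf by (simp add: normal_form_def)
  have step: "foldr push (x # u) p = shift_exp \<alpha> (push x (foldr push w p))"
    using Cons nf by (simp add: push_shift)
  show ?case
  proof (cases "\<exists>v. w = cletter x # v")
    case True
    then obtain v where v: "w = cletter x # v" by blast
    show ?thesis
      using step nf' v push_push[OF reduced_word_foldr[OF assms], of x v]
      by (auto simp: shift_exp_def fun_eq_iff)
  next
    case False
    then have "push x (\<alpha>, w) = (\<alpha>, x # w)" by (cases w) auto
    then show ?thesis using step nf' by simp
  qed
qed

lemma normal_form_append:
  "normal_form (u @ v) =
     shift_exp (fst (normal_form u)) (foldr push (snd (normal_form u)) (normal_form v))"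
  using foldr_push_normal_form[OF reduced_word_normal_form, of u v]
  by (simp add: normal_form_def)

definition word_star :: "'n letter list \<Rightarrow> 'n letter list" where
  "word_star w = rev (map cletter w)"

lemma reduced_word_append_single:
  "reduced_word (u @ [y]) \<Longrightarrow> x \<noteq> cletter y \<Longrightarrow> reduced_word (u @ [y, x])"
  by (induction u rule: reduced_word.induct) auto

lemma reduced_word_star: "reduced_word w \<Longrightarrow> reduced_word (word_star w)"
proof (induction w rule: reduced_word.induct)
  case (1 x y w)
  then have "cletter x \<noteq> cletter (cletter y)" by auto
  then show ?case using 1 by (auto simp: word_star_def intro!: reduced_word_append_single)
qed (auto simp: word_star_def)

lemma normal_form_word_star:
  "normal_form (word_star u) = (fst (normal_form u), word_star (snd (normal_form u)))"
proof (induction u)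
  case Nil
  then show ?case by (simp add: normal_form_def word_star_def)
next
  case (Cons x u)
  obtain \<alpha> w where nf: "normal_form u = (\<alpha>, w)" by fastforce
  have nf': "normal_form (x # u) = push x (\<alpha>, w)"
    using nf by (simp add: normal_form_def)
  have red: "reduced_word w" using reduced_word_normal_form[of u] nf by simp
  have step: "normal_form (word_star (x # u)) =
      shift_exp \<alpha> (foldr push (word_star w) (\<lambda>_. 0, [cletter x]))"
    using normal_form_append[of "word_star u" "[cletter x]"] Cons nf
    by (simp add: word_star_def normal_form_def)
  show ?case
  proof (cases "\<exists>v. w = cletter x # v")
    case True
    then obtain v where v: "w = cletter x # v" by blast
    let ?e = "(\<lambda>_. 0)(idx x := 1)"
    have "foldr push (word_star w) (\<lambda>_. 0, [cletter x]) =
        foldr push (word_star v) (shift_exp ?e (\<lambda>_. 0, []))"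
      using v by (simp add: word_star_def shift_exp_def cong: if_cong) (simp add: fun_upd_def cong: if_cong)
    also have "\<dots> = shift_exp ?e (normal_form (word_star v))"
      by (simp only: foldr_push_shift normal_form_def)
    also have "\<dots> = shift_exp ?e (\<lambda>_. 0, word_star v)"
      using normal_form_reduced[OF reduced_word_star[OF reduced_word_Cons]] red v by metis
    finally show ?thesis using step nf' v by (simp add: shift_exp_def fun_eq_iff)
  next
    case False
    then have p: "push x (\<alpha>, w) = (\<alpha>, x # w)" by (cases w) auto
    moreover have "reduced_word (x # w)" using False red by (cases w) auto
    then have "normal_form (word_star (x # w)) = (\<lambda>_. 0, word_star (x # w))"
      by (intro normal_form_reduced reduced_word_star)
    ultimately show ?thesis using step nf'
      by (simp add: word_star_def shift_exp_def normal_form_def)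
  qed
qed

quotient_type 'n qword = "'n letter list" / "\<lambda>u v. normal_form u = normal_form v"
  by (intro equivpI reflpI sympI transpI) auto

text \<open>The monoid of words is written additively, since the product of \<^typ>\<open>'a \<Rightarrow>\<^sub>0 'b\<close> is the
  convolution product over an additive (here noncommutative) monoid of exponents.\<close>

instantiation qword :: (type) monoid_add
begin

lift_definition zero_qword :: "'a qword" is "[]" .

lift_definition plus_qword :: "'a qword \<Rightarrow> 'a qword \<Rightarrow> 'a qword" is "(@)"
  by (simp add: normal_form_append)

instance
  by standard (transfer; simp)+

end

lift_definition letter_word :: "'n letter \<Rightarrow> 'n qword" is "\<lambda>x. [x]" .

lift_definition qword_star :: "'n qword \<Rightarrow> 'n qword" is word_star
  by (simp add: normal_form_word_star)


section \<open>The free algebra and evaluation\<close>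

type_synonym 'n qpoly = "'n qword \<Rightarrow>\<^sub>0 real"

definition qconst :: "real \<Rightarrow> 'n qpoly" where
  "qconst r = Poly_Mapping.single 0 r"

definition qvar :: "'n \<Rightarrow> 'n qpoly" where
  "qvar i = Poly_Mapping.single (letter_word (Ltr i)) 1"

definition qvar_bar :: "'n \<Rightarrow> 'n qpoly" where
  "qvar_bar i = Poly_Mapping.single (letter_word (CLtr i)) 1"

definition qstar :: "'n qpoly \<Rightarrow> 'n qpoly" where
  "qstar p = (\<Sum>w\<in>Poly_Mapping.keys p.
     Poly_Mapping.single (qword_star w) (Poly_Mapping.lookup p w))"

definition Sym :: "'n qpoly set" where
  "Sym = {p. qstar p = p}"

primrec eval_letter :: "quat ^ 'n \<Rightarrow> 'n letter \<Rightarrow> quat" where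
  "eval_letter a (Ltr i) = a $ i"
| "eval_letter a (CLtr i) = qcnj (a $ i)"

lemma eval_normal_form:
  fixes a :: "quat ^ 'n::finite"
  shows "prod_list (map (eval_letter a) u) =
    of_real (\<Prod>i\<in>UNIV. qnorm2 (a $ i) ^ fst (normal_form u) i) *
    prod_list (map (eval_letter a) (snd (normal_form u)))"
proof (induction u)
  case Nil
  then show ?case by (simp add: normal_form_def)
next
  case (Cons x u)
  let ?P = "\<lambda>\<alpha>. \<Prod>i\<in>UNIV. qnorm2 (a $ i) ^ \<alpha> i"
  obtain \<alpha> w where nf: "normal_form u = (\<alpha>, w)" by fastforce
  have nf': "normal_form (x # u) = push x (\<alpha>, w)"
    using nf by (simp add: normal_form_def)
  have step: "prod_list (map (eval_letter a) (x # u)) =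
      of_real (?P \<alpha>) * (eval_letter a x * prod_list (map (eval_letter a) w))"
    using Cons nf by (simp add: mult.assoc) (metis mult.assoc of_real_quat_commute)
  show ?case
  proof (cases "\<exists>v. w = cletter x # v")
    case True
    then obtain v where v: "w = cletter x # v" by blast
    have c: "eval_letter a x * (eval_letter a (cletter x) * z) = of_real (qnorm2 (a $ idx x)) * z"
      for z by (cases x) (simp_all add: mult_qcnj flip: mult.assoc)
    have "?P (\<alpha>(idx x := Suc (\<alpha> (idx x)))) =
        (\<Prod>i\<in>UNIV. qnorm2 (a $ i) ^ \<alpha> i * (if i = idx x then qnorm2 (a $ i) else 1))"
      by (intro prod.cong) auto
    also have "\<dots> = ?P \<alpha> * qnorm2 (a $ idx x)"
      by (simp add: prod.distrib)
    finally have "?P (\<alpha>(idx x := Suc (\<alpha> (idx x)))) = ?P \<alpha> * qnorm2 (a $ idx x)" .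
    then show ?thesis using step nf' v by (simp add: c mult.assoc)
  next
    case False
    then have "push x (\<alpha>, w) = (\<alpha>, x # w)" by (cases w) auto
    then show ?thesis using step nf' by simp
  qed
qed

lift_definition eval_word :: "quat ^ 'n::finite \<Rightarrow> 'n qword \<Rightarrow> quat"
  is "\<lambda>a w. prod_list (map (eval_letter a) w)"
  by (metis eval_normal_form)

definition qeval :: "quat ^ 'n::finite \<Rightarrow> 'n qpoly \<Rightarrow> quat" where
  "qeval a p = (\<Sum>w\<in>Poly_Mapping.keys p. Poly_Mapping.lookup p w *\<^sub>R eval_word a w)"

definition semialg_set ::
  "nat \<Rightarrow> (nat \<Rightarrow> 'n::finite qpoly) \<Rightarrow> nat \<Rightarrow> (nat \<Rightarrow> 'n qpoly) \<Rightarrow> (quat ^ 'n) set" where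
  "semialg_set m g l h =
     {a. (\<forall>i\<in>{1..m}. 0 \<le> qeval a (g i)) \<and> (\<forall>j\<in>{1..l}. qeval a (h j) = 0)}"

definition vanishing_ideal :: "'n::finite qpoly set" where
  "vanishing_ideal = {p. \<forall>a. qeval a p = 0}"

definition SOS :: "'n qpoly set" where
  "SOS = {\<Sum>s<k. qstar (p s) * p s |(k :: nat) p. True}"

definition quad_module ::
  "nat \<Rightarrow> (nat \<Rightarrow> 'n qpoly) \<Rightarrow> nat \<Rightarrow> (nat \<Rightarrow> 'n qpoly) \<Rightarrow> 'n qpoly set" where
  "quad_module m g l h =
     {\<sigma> 0 + qconst (1/2) * (\<Sum>i\<in>{1..m}. \<sigma> i * g i + g i * \<sigma> i)
        + (\<Sum>j\<in>{1..l}. \<Sum>\<alpha><N j. \<tau> j \<alpha> * h j * \<nu> j \<alpha>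
             + qstar (\<nu> j \<alpha>) * qstar (h j) * qstar (\<tau> j \<alpha>))
      |\<sigma> (N :: nat \<Rightarrow> nat) \<tau> \<nu>. \<forall>i\<in>{0..m}. \<sigma> i \<in> SOS}"

definition archimedean :: "'n::finite qpoly set \<Rightarrow> bool" where
  "archimedean M \<longleftrightarrow> (\<exists>R>0. qconst R - (\<Sum>i\<in>UNIV. qvar i * qvar_bar i) \<in> M)"


section \<open>The quotient algebras\<close>

definition free_alg :: "'n qpoly ring" where
  "free_alg = \<lparr>carrier = UNIV, monoid.mult = (*), one = 1, zero = 0, add = (+)\<rparr>"

text \<open>The involution \<open>s\<close> of a ring induces on each quotient by a $*$-ideal the involution
  \<open>(`) s\<close> of cosets.\<close>

definition star_ideal :: "('a \<Rightarrow> 'a) \<Rightarrow> ('a, 'b) ring_scheme \<Rightarrow> 'a set \<Rightarrow> bool" where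
  "star_ideal s R J \<longleftrightarrow> ideal J R \<and> s ` J \<subseteq> J"

definition gen_star_ideal :: "('a \<Rightarrow> 'a) \<Rightarrow> ('a, 'b) ring_scheme \<Rightarrow> 'a set \<Rightarrow> 'a set" where
  "gen_star_ideal s R S = \<Inter>{J. star_ideal s R J \<and> S \<subseteq> J}"

definition alg_A :: "'n::finite qpoly set ring" where
  "alg_A = free_alg Quot vanishing_ideal"

definition star_A :: "'n qpoly set \<Rightarrow> 'n qpoly set" where
  "star_A = (`) qstar"

definition proj_A :: "'n::finite qpoly \<Rightarrow> 'n qpoly set" where
  "proj_A p = vanishing_ideal +>\<^bsub>free_alg\<^esub> p"

definition ideal_J :: "nat \<Rightarrow> (nat \<Rightarrow> 'n::finite qpoly) \<Rightarrow> 'n qpoly set set" where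
  "ideal_J l h = gen_star_ideal star_A alg_A ((\<lambda>j. proj_A (h j)) ` {1..l})"

definition alg_Ah :: "nat \<Rightarrow> (nat \<Rightarrow> 'n::finite qpoly) \<Rightarrow> 'n qpoly set set ring" where
  "alg_Ah l h = alg_A Quot ideal_J l h"

definition star_Ah :: "'n qpoly set set \<Rightarrow> 'n qpoly set set" where
  "star_Ah = (`) star_A"

definition hat :: "nat \<Rightarrow> (nat \<Rightarrow> 'n::finite qpoly) \<Rightarrow> 'n qpoly \<Rightarrow> 'n qpoly set set" where
  "hat l h p = ideal_J l h +>\<^bsub>alg_A\<^esub> proj_A p"

definition quad_module_Ah ::
  "nat \<Rightarrow> (nat \<Rightarrow> 'n::finite qpoly) \<Rightarrow> nat \<Rightarrow> (nat \<Rightarrow> 'n qpoly) \<Rightarrow> 'n qpoly set set set" where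
  "quad_module_Ah m g l h =
     {(\<Oplus>\<^bsub>alg_Ah l h\<^esub>\<alpha>\<in>{..<N 0}. star_Ah (p 0 \<alpha>) \<otimes>\<^bsub>alg_Ah l h\<^esub> p 0 \<alpha>)
        \<oplus>\<^bsub>alg_Ah l h\<^esub>
      (\<Oplus>\<^bsub>alg_Ah l h\<^esub>i\<in>{1..m}. \<Oplus>\<^bsub>alg_Ah l h\<^esub>\<alpha>\<in>{..<N i}.
         star_Ah (p i \<alpha>) \<otimes>\<^bsub>alg_Ah l h\<^esub> hat l h (g i) \<otimes>\<^bsub>alg_Ah l h\<^esub> p i \<alpha>)
      |(N :: nat \<Rightarrow> nat) p. \<forall>i\<in>{0..m}. \<forall>\<alpha><N i. p i \<alpha> \<in> carrier (alg_Ah l h)}"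

end

theory Submission
  imports Defs
begin

text \<open>On $\mathbb H^n$ every symmetric element is real-valued, hence central, so the statement lives in the
  commutative algebra of the functions \<open>Re p\<close>, where the quadratic module becomes
  \<open>\<Sigma>|p|\<^sup>2 + \<Sigma> |p|\<^sup>2 g\<^sub>i + \<Sigma> Re (p h\<^sub>j)\<close>.  There it is an Archimedean quadratic module, so if \<open>f\<close> were
  not a member, the Jacobi--Putinar representation theorem would give a real character \<open>\<phi>\<close> that is
  nonnegative on the module with \<open>\<phi> f \<le> 0\<close>.  The form \<open>\<phi> (Re (p\<^sup>* q))\<close> is positive semidefinite and
  its norm is multiplicative, so dividing out null elements leaves a real division algebra as in
  Frobenius' theorem; embedding it into the quaternions shows that \<open>\<phi>\<close> is the evaluation at a point
  of \<open>K\<close>, where \<open>f > 0\<close>.\<close>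

section \<open>Archimedean quadratic modules of real functions\<close>

text \<open>Real parts are invariant under simultaneous conjugation of all letters by a unit
  quaternion, so the imaginary components of \<open>p\<close> are not among them and
  \<open>|p|^2\<close> need not be a sum of squares of real parts. For one letter the real parts
  form the polynomial ring in the independent functions \<open>Re q\<close> and
  \<open>|q|^2\<close>, where \<open>|q|^2\<close> is no sum of squares. Stability of the module
  under every \<open>|p|^2\<close> is therefore an extra property: it bounds products of letters,
  and it excludes characters that come from no quaternion point. By the same invariance a character
  determines its point only up to a rotation; the choice of an orthonormal pair of imaginary
  elements fixes the frame. No bound on the dimension of the quotient by null elements is available
  beforehand. The substitute is that \<open>x + qstar x\<close> and \<open>qstar x * x\<close> are
  real-valued, which makes every imaginary \<open>x\<close> square to \<open>- N x\<close>.\<close>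

inductive_set sums_of_squares :: "('x \<Rightarrow> real) set \<Rightarrow> ('x \<Rightarrow> real) set" for C where
  square: "c \<in> C \<Longrightarrow> (\<lambda>x. (c x)\<^sup>2) \<in> sums_of_squares C"
| add: "s \<in> sums_of_squares C \<Longrightarrow> t \<in> sums_of_squares C \<Longrightarrow> (\<lambda>x. s x + t x) \<in> sums_of_squares C"

definition quadratic_module :: "('x \<Rightarrow> real) set \<Rightarrow> ('x \<Rightarrow> real) set \<Rightarrow> bool" where
  "quadratic_module C Q \<longleftrightarrow> Q \<subseteq> C \<and> (\<lambda>_. 1) \<in> Q \<and>
     (\<forall>a\<in>Q. \<forall>b\<in>Q. (\<lambda>x. a x + b x) \<in> Q) \<and> (\<forall>c\<in>C. \<forall>a\<in>Q. (\<lambda>x. (c x)\<^sup>2 * a x) \<in> Q)"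

text \<open>Concrete functions stand in for an abstract commutative algebra, so ring identities
  reduce to real arithmetic at a point. Positivity of a function, by contrast, means membership in
  \<open>Q\<close>, not its pointwise sign.\<close>

locale function_algebra =
  fixes C :: "('x \<Rightarrow> real) set"
  assumes const: "(\<lambda>_. r) \<in> C"
    and add: "a \<in> C \<Longrightarrow> b \<in> C \<Longrightarrow> (\<lambda>x. a x + b x) \<in> C"
    and mult: "a \<in> C \<Longrightarrow> b \<in> C \<Longrightarrow> (\<lambda>x. a x * b x) \<in> C"
begin

lemma diff: "a \<in> C \<Longrightarrow> b \<in> C \<Longrightarrow> (\<lambda>x. a x - b x) \<in> C"
  using add[OF _ mult[OF const[of "-1"]], of a b] by simp

lemma uminus: "a \<in> C \<Longrightarrow> (\<lambda>x. - a x) \<in> C"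
  using mult[OF const[of "-1"], of a] by simp

lemma power2: "a \<in> C \<Longrightarrow> (\<lambda>x. (a x)\<^sup>2) \<in> C"
  using mult[of a a] by (simp add: power2_eq_square)

lemmas closed = const add mult diff uminus power2

lemma sums_of_squares_closed: "s \<in> sums_of_squares C \<Longrightarrow> s \<in> C"
  by (induction rule: sums_of_squares.induct) (auto intro: closed)

lemma sums_of_squares_square_mult:
  "s \<in> sums_of_squares C \<Longrightarrow> c \<in> C \<Longrightarrow> (\<lambda>x. (c x)\<^sup>2 * s x) \<in> sums_of_squares C"
proof (induction rule: sums_of_squares.induct)
  case (square d)
  then show ?case
    using sums_of_squares.square[OF mult, of c d] by (simp add: power_mult_distrib)
next
  case (add s t)
  then show ?case
    using sums_of_squares.add[of "\<lambda>x. (c x)\<^sup>2 * s x" C "\<lambda>x. (c x)\<^sup>2 * t x"] by (simp add: algebra_simps)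
qed

lemma sums_of_squares_const: "r \<ge> 0 \<Longrightarrow> (\<lambda>_. r) \<in> sums_of_squares C"
  using sums_of_squares.square[OF const[of "sqrt r"]] by simp

context
  fixes Q assumes Q: "quadratic_module C Q"
begin

lemma qm_closed: "a \<in> Q \<Longrightarrow> a \<in> C"
  using Q by (auto simp: quadratic_module_def)

lemma qm_add: "a \<in> Q \<Longrightarrow> b \<in> Q \<Longrightarrow> (\<lambda>x. a x + b x) \<in> Q"
  using Q by (auto simp: quadratic_module_def)

lemma qm_square_mult: "c \<in> C \<Longrightarrow> a \<in> Q \<Longrightarrow> (\<lambda>x. (c x)\<^sup>2 * a x) \<in> Q"
  using Q by (auto simp: quadratic_module_def)

lemma qm_sos_mult: "s \<in> sums_of_squares C \<Longrightarrow> a \<in> Q \<Longrightarrow> (\<lambda>x. s x * a x) \<in> Q"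
proof (induction rule: sums_of_squares.induct)
  case (square c)
  then show ?case by (rule qm_square_mult)
next
  case (add s t)
  then show ?case using qm_add[of "\<lambda>x. s x * a x" "\<lambda>x. t x * a x"] by (simp add: algebra_simps)
qed

lemma qm_one: "(\<lambda>_. 1) \<in> Q"
  using Q by (auto simp: quadratic_module_def)

lemma qm_sos: "s \<in> sums_of_squares C \<Longrightarrow> s \<in> Q"
  using qm_sos_mult[OF _ qm_one, of s] by simp

lemma qm_scale: "r \<ge> 0 \<Longrightarrow> a \<in> Q \<Longrightarrow> (\<lambda>x. r * a x) \<in> Q"
  using qm_sos_mult[OF sums_of_squares_const] by auto

lemma qm_const: "r \<ge> 0 \<Longrightarrow> (\<lambda>_. r) \<in> Q"
  using qm_sos[OF sums_of_squares_const] by auto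

text \<open>\<open>c = ((c + 1)/2)^2 - ((c - 1)/2)^2\<close> is a difference of two squares; the
  first multiplies \<open>a\<close>, the second \<open>-a\<close>. This makes the support
  \<open>Q \<inter> -Q\<close> an ideal.\<close>

lemma qm_support_mult:
  assumes a: "a \<in> Q" "(\<lambda>x. - a x) \<in> Q" and c: "c \<in> C"
  shows "(\<lambda>x. a x * c x) \<in> Q"
proof -
  have "(\<lambda>x. c x * (1 / 2) + 1 / 2) \<in> C" "(\<lambda>x. c x * (1 / 2) + - 1 / 2) \<in> C"
    by (intro add mult const c)+
  then have "(\<lambda>x. (c x * (1 / 2) + 1 / 2)\<^sup>2 * a x + (c x * (1 / 2) + - 1 / 2)\<^sup>2 * - a x) \<in> Q"
    using a by (intro qm_add qm_square_mult)
  also have "(\<lambda>x. (c x * (1 / 2) + 1 / 2)\<^sup>2 * a x + (c x * (1 / 2) + - 1 / 2)\<^sup>2 * - a x) =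
      (\<lambda>x. a x * c x)"
    by (simp add: fun_eq_iff power2_eq_square field_simps)
  finally show ?thesis .
qed

text \<open>The product of two members of a quadratic module need not be a member, but it is when the
  two add up to a positive constant.\<close>

lemma qm_mult_complement:
  assumes k: "k > 0" and a: "a \<in> Q" "(\<lambda>x. k - a x) \<in> Q"
  shows "(\<lambda>x. a x * (k - a x)) \<in> Q"
proof -
  have "(\<lambda>x. (1 / k) * ((k - a x)\<^sup>2 * a x + (a x)\<^sup>2 * (k - a x))) \<in> Q"
    using a k by (intro qm_scale qm_add qm_square_mult closed qm_closed) auto
  also have "(\<lambda>x. (1 / k) * ((k - a x)\<^sup>2 * a x + (a x)\<^sup>2 * (k - a x))) = (\<lambda>x. a x * (k - a x))"
    using k by (simp add: fun_eq_iff power2_eq_square field_simps)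
  finally show ?thesis .
qed

text \<open>Coefficients are sums of squares because single squares need not be closed under
  addition. Maximality is exploited by adjoining \<open>c\<close> and \<open>-c\<close>; adjoining
  \<open>-f\<close> later forces the sign of \<open>\<phi> f\<close>.\<close>

lemma qm_adjoin:
  assumes c: "c \<in> C"
  defines "Q' \<equiv> {\<lambda>x. q x + s x * c x |q s. q \<in> Q \<and> s \<in> sums_of_squares C}"
  shows "quadratic_module C Q'" "Q \<subseteq> Q'" "c \<in> Q'"
proof -
  show sub: "Q \<subseteq> Q'"
  proof
    fix q assume "q \<in> Q"
    then show "q \<in> Q'"
      unfolding Q'_def using sums_of_squares_const[of 0] by (intro CollectI exI[of _ q] exI[of _ "\<lambda>_. 0"]) auto
  qed
  show "c \<in> Q'"
    unfolding Q'_def using sums_of_squares_const[of 1] qm_const[of 0]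
    by (intro CollectI exI[of _ "\<lambda>_. 0"] exI[of _ "\<lambda>_. 1"]) auto
  have "Q' \<subseteq> C"
  proof
    fix a assume "a \<in> Q'"
    then obtain q s where "q \<in> Q" "s \<in> sums_of_squares C" "a = (\<lambda>x. q x + s x * c x)"
      unfolding Q'_def by blast
    then show "a \<in> C"
      using c add[OF qm_closed mult[OF sums_of_squares_closed]] by blast
  qed
  moreover have "(\<lambda>x. a x + b x) \<in> Q'" if ab: "a \<in> Q'" "b \<in> Q'" for a b
  proof -
    obtain p s q t where *: "p \<in> Q" "s \<in> sums_of_squares C" "a = (\<lambda>x. p x + s x * c x)"
      "q \<in> Q" "t \<in> sums_of_squares C" "b = (\<lambda>x. q x + t x * c x)"
      using ab unfolding Q'_def by auto
    then show ?thesis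
      unfolding Q'_def
      by (intro CollectI exI[of _ "\<lambda>x. p x + q x"] exI[of _ "\<lambda>x. s x + t x"])
         (auto simp: algebra_simps intro: qm_add sums_of_squares.add)
  qed
  moreover have "(\<lambda>x. (d x)\<^sup>2 * a x) \<in> Q'" if d: "d \<in> C" and a: "a \<in> Q'" for a d
  proof -
    obtain p s where *: "p \<in> Q" "s \<in> sums_of_squares C" "a = (\<lambda>x. p x + s x * c x)"
      using a unfolding Q'_def by auto
    have "(\<lambda>x. (d x)\<^sup>2 * a x) = (\<lambda>x. (d x)\<^sup>2 * p x + (d x)\<^sup>2 * s x * c x)"
      using *(3) by (simp add: algebra_simps)
    then show ?thesis
      unfolding Q'_def using qm_square_mult[OF d *(1)] sums_of_squares_square_mult[OF *(2) d]
      by (intro CollectI exI[of _ "\<lambda>x. (d x)\<^sup>2 * p x"] exI[of _ "\<lambda>x. (d x)\<^sup>2 * s x"] conjI)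
  qed
  ultimately show "quadratic_module C Q'"
    using sub qm_one by (auto simp: quadratic_module_def)
qed

end

text \<open>If \<open>f + r\<close> is a member for some \<open>r \<ge> 0\<close>, then so is \<open>f + r - 1 / k\<^sup>2\<close> for a fixed large \<open>k\<close>
  (Marshall's identity below), so that \<open>r\<close> can be lowered to zero.\<close>

lemma mem_qm_of_sos_mult:
  assumes Q: "quadratic_module C Q" and arch: "\<And>c. c \<in> C \<Longrightarrow> \<exists>k. (\<lambda>x. k - c x) \<in> Q"
    and f: "f \<in> C" and s: "s \<in> sums_of_squares C" and sf: "(\<lambda>x. s x * f x - 1) \<in> Q"
  shows "f \<in> Q"
proof -
  have C: "s \<in> C" "(\<lambda>x. (s x)\<^sup>2 * f x) \<in> C" "(\<lambda>x. - f x) \<in> C"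
    by (intro closed sums_of_squares_closed s f)+
  have shift: "(\<lambda>x. k' - c x) \<in> Q" if "(\<lambda>x. k - c x) \<in> Q" "k \<le> k'" for k k' c
    using qm_add[OF Q that(1) qm_const[OF Q, of "k' - k"]] that(2) by simp
  obtain k1 k2 where k12: "(\<lambda>x. k1 - s x) \<in> Q" "(\<lambda>x. k2 - (s x)\<^sup>2 * f x) \<in> Q"
    using arch[OF C(1)] arch[OF C(2)] by blast
  \<comment> \<open>Besides being positive, \<open>k\<close> must make \<open>2 * k - s\<close> and
    \<open>2 * k - 1 - s^2 * f\<close> members, the two complements used in the identity.\<close>
  define k where "k = max 1 (max k1 (k2 + 1))"
  have "1 \<le> k" "k1 \<le> k" "k2 + 1 \<le> k" by (simp_all add: k_def)
  then have k_bounds: "k1 \<le> 2 * k" "k2 \<le> 2 * k - 1" by linarith+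
  have k: "k > 0" "(\<lambda>x. 2 * k - s x) \<in> Q" "(\<lambda>x. (2 * k - 1) - (s x)\<^sup>2 * f x) \<in> Q"
    using shift[OF k12(1) k_bounds(1)] shift[OF k12(2) k_bounds(2)] by (simp_all add: k_def)
  have step: "(\<lambda>x. f x + (r - 1 / k\<^sup>2)) \<in> Q" if r: "r \<ge> 0" "(\<lambda>x. f x + r) \<in> Q" for r
  proof -
    have A1: "(\<lambda>x. (k - s x)\<^sup>2 * (f x + r)) \<in> Q"
      by (intro qm_square_mult[OF Q diff[OF const C(1)] r(2)])
    have A2: "(\<lambda>x. 2 * k * (s x * f x - 1)) \<in> Q"
      using k(1) by (intro qm_scale[OF Q _ sf]) simp
    have A3: "(\<lambda>x. r * (s x * (2 * k - s x))) \<in> Q"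
      using k(1) by (intro qm_scale[OF Q r(1)] qm_mult_complement[OF Q _ qm_sos[OF Q s] k(2)]) simp
    \<comment> \<open>Since \<open>(k - s)^2 = k^2 - s * (2 * k - s)\<close>, the terms in
      \<open>r\<close> add up to \<open>k^2 * r\<close>, those in \<open>f\<close> to
      \<open>k^2 * f\<close>, and the constants to \<open>-2 * k + (2 * k - 1) = -1\<close>.\<close>
    have "(\<lambda>x. (1 / k\<^sup>2) * ((k - s x)\<^sup>2 * (f x + r) + 2 * k * (s x * f x - 1)
        + r * (s x * (2 * k - s x)) + ((2 * k - 1) - (s x)\<^sup>2 * f x))) \<in> Q"
      by (intro qm_scale[OF Q _ qm_add[OF Q qm_add[OF Q qm_add[OF Q A1 A2] A3] k(3)]]) simp
    also have "(\<lambda>x. (1 / k\<^sup>2) * ((k - s x)\<^sup>2 * (f x + r) + 2 * k * (s x * f x - 1)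
        + r * (s x * (2 * k - s x)) + ((2 * k - 1) - (s x)\<^sup>2 * f x))) = (\<lambda>x. f x + (r - 1 / k\<^sup>2))"
    proof
      fix x
      have "(k - s x)\<^sup>2 * (f x + r) + 2 * k * (s x * f x - 1)
        + r * (s x * (2 * k - s x)) + ((2 * k - 1) - (s x)\<^sup>2 * f x) = k\<^sup>2 * (f x + r) - 1"
        by (simp add: power2_eq_square algebra_simps)
      then show "(1 / k\<^sup>2) * ((k - s x)\<^sup>2 * (f x + r) + 2 * k * (s x * f x - 1)
        + r * (s x * (2 * k - s x)) + ((2 * k - 1) - (s x)\<^sup>2 * f x)) = f x + (r - 1 / k\<^sup>2)"
        using k(1) by (simp add: field_simps)
    qed
    finally show ?thesis .
  qed
  obtain r0 where r0: "(\<lambda>x. f x + r0) \<in> Q"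
    using arch[OF C(3)] by (auto simp: add.commute)
  \<comment> \<open>The outer \<open>max 0\<close> keeps the shift nonnegative, as
    \<open>step\<close> demands; where a decrement overshoots zero, a nonnegative constant is added
    back.\<close>
  have down: "(\<lambda>x. f x + max 0 (max 0 r0 - real j / k\<^sup>2)) \<in> Q" for j
  proof (induction j)
    case 0
    then show ?case using qm_add[OF Q r0 qm_const[OF Q, of "max 0 r0 - r0"]] by simp
  next
    case (Suc j)
    let ?r = "max 0 (max 0 r0 - real j / k\<^sup>2)" and ?r' = "max 0 (max 0 r0 - real (Suc j) / k\<^sup>2)"
    have "real (Suc j) / k\<^sup>2 = real j / k\<^sup>2 + 1 / k\<^sup>2" "1 / k\<^sup>2 \<ge> 0"
      by (auto simp: add_divide_distrib)
    then have "?r' - (?r - 1 / k\<^sup>2) \<ge> 0"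
      by linarith
    from qm_add[OF Q step[OF _ Suc] qm_const[OF Q this]] show ?case by simp
  qed
  obtain j where "max 0 r0 * k\<^sup>2 \<le> real j"
    using real_arch_simple by blast
  then have "max 0 (max 0 r0 - real j / k\<^sup>2) = 0"
    using k(1) by (simp add: field_simps)
  with down[of j] show ?thesis by simp
qed

section \<open>Maximal proper quadratic modules and their characters\<close>

lemma ex_maximal_qm:
  assumes Q: "quadratic_module C Q" and proper: "(\<lambda>_. -1) \<notin> Q"
  shows "\<exists>P. quadratic_module C P \<and> (\<lambda>_. -1) \<notin> P \<and> Q \<subseteq> P \<and>
    (\<forall>P'. quadratic_module C P' \<longrightarrow> (\<lambda>_. -1) \<notin> P' \<longrightarrow> P \<subseteq> P' \<longrightarrow> P' = P)"
proof -
  let ?A = "{P. quadratic_module C P \<and> (\<lambda>_. -1) \<notin> P \<and> Q \<subseteq> P}"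
  have "\<exists>P\<in>?A. \<forall>P'\<in>?A. P \<subseteq> P' \<longrightarrow> P' = P"
  proof (rule subset_Zorn_nonempty)
    show "?A \<noteq> {}" using assms by auto
    fix \<C> assume ne: "\<C> \<noteq> {}" and ch: "subset.chain ?A \<C>"
    have mem: "P \<in> ?A" if "P \<in> \<C>" for P
      using ch that by (auto simp: subset_chain_def)
    have lin: "P \<subseteq> P' \<or> P' \<subseteq> P" if "P \<in> \<C>" "P' \<in> \<C>" for P P'
      using ch that by (auto simp: subset_chain_def)
    have "(\<lambda>x. a x + b x) \<in> \<Union>\<C>" if ab: "a \<in> \<Union>\<C>" "b \<in> \<Union>\<C>" for a b
    proof -
      obtain P P' where P: "P \<in> \<C>" "P' \<in> \<C>" "a \<in> P" "b \<in> P'" using ab by auto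
      with lin obtain P'' where "P'' \<in> \<C>" "a \<in> P''" "b \<in> P''" by blast
      then show ?thesis using mem[of P''] qm_add[of P'' a b] by blast
    qed
    moreover have "(\<lambda>_. 1) \<in> \<Union>\<C>" using ne mem qm_one by blast
    moreover have "\<Union>\<C> \<subseteq> C" using mem qm_closed by blast
    moreover have "(\<lambda>x. (c x)\<^sup>2 * a x) \<in> \<Union>\<C>" if "c \<in> C" "a \<in> \<Union>\<C>" for a c
      using that mem qm_square_mult by blast
    ultimately have "quadratic_module C (\<Union>\<C>)"
      by (auto simp: quadratic_module_def)
    then show "\<Union>\<C> \<in> ?A" using ne mem by blast
  qed
  then obtain P where P: "P \<in> ?A" "\<forall>P'\<in>?A. P \<subseteq> P' \<longrightarrow> P' = P" by blast
  show ?thesis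
    using P by (intro exI[of _ P]) auto
qed

text \<open>If neither sign belongs to \<open>P\<close>, both adjunctions contain \<open>-1\<close>,
  say \<open>-1 = q1 + s1 c\<close> and \<open>-1 = q2 - s2 c\<close>. Eliminating \<open>c\<close>
  gives \<open>-s1 = s2 + s2 q1 + s1 q2\<close> in \<open>P\<close>, so \<open>s1\<close> lies in
  the support. Then \<open>s1 c\<close> is in \<open>P\<close> too, and with it
  \<open>-1\<close>.\<close>

lemma maximal_qm_total:
  assumes P: "quadratic_module C P" and proper: "(\<lambda>_. -1) \<notin> P"
    and max: "\<And>P'. quadratic_module C P' \<Longrightarrow> (\<lambda>_. -1) \<notin> P' \<Longrightarrow> P \<subseteq> P' \<Longrightarrow> P' = P"
    and c: "c \<in> C"
  shows "c \<in> P \<or> (\<lambda>x. - c x) \<in> P"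
proof (rule ccontr)
  assume neg: "\<not> ?thesis"
  have ex: "\<exists>q s. q \<in> P \<and> s \<in> sums_of_squares C \<and> (\<forall>x. -1 = q x + s x * d x)"
    if d: "d \<in> C" "d \<notin> P" for d
  proof -
    let ?P' = "{\<lambda>x. q x + s x * d x |q s. q \<in> P \<and> s \<in> sums_of_squares C}"
    have "(\<lambda>_. -1) \<in> ?P'"
      using qm_adjoin[OF P d(1)] max[of ?P'] d(2) by blast
    then obtain q s where "(\<lambda>_. -1) = (\<lambda>x. q x + s x * d x)" "q \<in> P" "s \<in> sums_of_squares C" by blast
    then show ?thesis by (metis (no_types))
  qed
  obtain q1 s1 where 1: "q1 \<in> P" "s1 \<in> sums_of_squares C" "\<And>x. -1 = q1 x + s1 x * c x"
    using ex[OF c] neg by blast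
  obtain q2 s2 where 2: "q2 \<in> P" "s2 \<in> sums_of_squares C" "\<And>x. -1 = q2 x + s2 x * - c x"
    using ex[OF uminus[OF c]] neg by blast
  have "(\<lambda>x. s2 x + (s2 x * q1 x + s1 x * q2 x)) \<in> P"
    using 1 2 by (intro qm_add[OF P] qm_sos_mult[OF P] qm_sos[OF P 2(2)]) auto
  also have "(\<lambda>x. s2 x + (s2 x * q1 x + s1 x * q2 x)) = (\<lambda>x. - s1 x)"
  proof
    fix x
    have eqs: "q1 x = -1 - s1 x * c x" "q2 x = -1 + s2 x * c x"
      using 1(3)[of x] 2(3)[of x] by linarith+
    show "s2 x + (s2 x * q1 x + s1 x * q2 x) = - s1 x"
      unfolding eqs by (simp add: algebra_simps)
  qed
  finally have "(\<lambda>x. s1 x * c x) \<in> P"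
    by (rule qm_support_mult[OF P qm_sos[OF P 1(2)] _ c])
  then have "(\<lambda>x. q1 x + s1 x * c x) \<in> P" using 1 by (intro qm_add[OF P])
  then show False using proper 1(3) by simp
qed

text \<open>\<open>P\<close> acts as the nonnegative cone of an ordering, and
  \<open>\<phi> c\<close> is the cut given by the constants below \<open>c\<close>, finite by the
  Archimedean hypothesis. Closure of \<open>P\<close> under products is not known, so
  multiplicativity goes through squares: first \<open>\<phi> (c^2) = 0\<close> when
  \<open>\<phi> c = 0\<close>, then translation and polarization.\<close>

lemma ex_character_of_maximal_qm:
  assumes P: "quadratic_module C P" and proper: "(\<lambda>_. -1) \<notin> P"
    and arch: "\<And>c. c \<in> C \<Longrightarrow> \<exists>k. (\<lambda>x. k - c x) \<in> P"
    and total: "\<And>c. c \<in> C \<Longrightarrow> c \<in> P \<or> (\<lambda>x. - c x) \<in> P"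
  obtains \<phi> where "\<And>r. \<phi> (\<lambda>_. r) = r"
    "\<And>a b. a \<in> C \<Longrightarrow> b \<in> C \<Longrightarrow> \<phi> (\<lambda>x. a x + b x) = \<phi> a + \<phi> b"
    "\<And>a b. a \<in> C \<Longrightarrow> b \<in> C \<Longrightarrow> \<phi> (\<lambda>x. a x * b x) = \<phi> a * \<phi> b"
    "\<And>a. a \<in> P \<Longrightarrow> \<phi> a \<ge> (0 :: real)"
proof -
  define \<phi> where "\<phi> c = Sup {r. (\<lambda>x. c x - r) \<in> P}" for c
  have nonneg: "r \<ge> 0" if "(\<lambda>_. r) \<in> P" for r
  proof (rule ccontr)
    assume "\<not> r \<ge> 0"
    then show False using qm_scale[OF P _ that, of "- 1 / r"] proper by auto
  qed
  have down: "(\<lambda>x. c x - r') \<in> P" if "(\<lambda>x. c x - r) \<in> P" "r' \<le> r" for c r r'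
    using qm_add[OF P that(1) qm_const[OF P, of "r - r'"]] that(2) by simp
  have le: "r \<le> k" if "(\<lambda>x. c x - r) \<in> P" "(\<lambda>x. k - c x) \<in> P" for c r k
    using nonneg[of "k - r"] qm_add[OF P that] by simp
  have ne: "\<exists>r. (\<lambda>x. c x - r) \<in> P" if "c \<in> C" for c
  proof -
    obtain k where "(\<lambda>x. k - - c x) \<in> P" using arch[OF uminus[OF \<open>c \<in> C\<close>]] by blast
    then show ?thesis by (intro exI[of _ "-k"]) (simp add: add.commute)
  qed
  have lower: "r \<le> \<phi> c" if "(\<lambda>x. c x - r) \<in> P" "c \<in> C" for c r
  proof -
    obtain k where "(\<lambda>x. k - c x) \<in> P" using arch[OF \<open>c \<in> C\<close>] by blast
    then have "bdd_above {r. (\<lambda>x. c x - r) \<in> P}" using le by (intro bdd_aboveI[of _ k]) auto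
    then show ?thesis unfolding \<phi>_def using that(1) by (intro cSup_upper) auto
  qed
  have upper: "\<phi> c \<le> k" if "(\<lambda>x. k - c x) \<in> P" "c \<in> C" for c k
    unfolding \<phi>_def using ne[OF that(2)] le that(1) by (intro cSup_least) auto
  have inl: "(\<lambda>x. c x - r) \<in> P" if "r < \<phi> c" "c \<in> C" for c r
  proof -
    have "\<exists>r'\<in>{r. (\<lambda>x. c x - r) \<in> P}. r < r'"
      using that ne[OF that(2)] less_cSupD[of "{r. (\<lambda>x. c x - r) \<in> P}" r] unfolding \<phi>_def by blast
    then show ?thesis using down[of c _ r] by auto
  qed
  have inu: "(\<lambda>x. k - c x) \<in> P" if "\<phi> c < k" "c \<in> C" for c k
  proof -
    have "(\<lambda>x. c x - k) \<notin> P" using lower[of c k] that by auto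
    then show ?thesis using total[OF diff[OF that(2) const[of k]]] by auto
  qed
  have nn: "\<phi> a \<ge> 0" if "a \<in> P" for a
    using lower[of a 0] that qm_closed[OF P that] by simp
  have cst: "\<phi> (\<lambda>_. r) = r" for r
    using lower[of "\<lambda>_. r" r] upper[of r "\<lambda>_. r"] qm_const[OF P, of 0] closed(1) by (simp add: antisym)
  have hom_add: "\<phi> (\<lambda>x. a x + b x) = \<phi> a + \<phi> b" if "a \<in> C" "b \<in> C" for a b
  proof -
    have le: "\<phi> (\<lambda>x. a x + b x) \<le> \<phi> a + \<phi> b + e \<and> \<phi> a + \<phi> b \<le> \<phi> (\<lambda>x. a x + b x) + e"
      if e: "e > 0" for e
    proof
    note ab = \<open>a \<in> C\<close> \<open>b \<in> C\<close>
    have "(\<lambda>x. (\<phi> a + e / 2 - a x) + (\<phi> b + e / 2 - b x)) \<in> P"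
      using e ab by (intro qm_add[OF P] inu) auto
    then show "\<phi> (\<lambda>x. a x + b x) \<le> \<phi> a + \<phi> b + e"
      using ab by (intro upper add) (auto simp: algebra_simps)
    have "(\<lambda>x. (a x - (\<phi> a - e / 2)) + (b x - (\<phi> b - e / 2))) \<in> P"
      using e ab by (intro qm_add[OF P] inl) auto
    then have "\<phi> a + \<phi> b - e \<le> \<phi> (\<lambda>x. a x + b x)"
      using ab by (intro lower add) (auto simp: algebra_simps)
    then show "\<phi> a + \<phi> b \<le> \<phi> (\<lambda>x. a x + b x) + e" by simp
    qed
    then show ?thesis by (meson antisym field_le_epsilon)
  qed
  have minus: "\<phi> (\<lambda>x. - a x) = - \<phi> a" if "a \<in> C" for a
    using hom_add[OF that uminus[OF that]] cst[of 0] by simp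
  have scale_nn: "\<phi> (\<lambda>x. r * a x) = r * \<phi> a" if "r > 0" "a \<in> C" for r a
  proof -
    have le: "r * \<phi> a \<le> \<phi> (\<lambda>x. r * a x)" if r: "r > 0" and a: "a \<in> C" for r a
    proof -
      have "y \<le> \<phi> (\<lambda>x. r * a x)" if "y < r * \<phi> a" for y
      proof -
        have "y / r < \<phi> a" using that r by (simp add: field_simps)
        then have "(\<lambda>x. r * (a x - y / r)) \<in> P" using inl[of "y / r" a] a r qm_scale[OF P] by simp
        then show ?thesis using r a by (intro lower mult const) (auto simp: algebra_simps)
      qed
      then show ?thesis by (rule dense_le)
    qed
    have "(1 / r) * \<phi> (\<lambda>x. r * a x) \<le> \<phi> a"
      using le[of "1 / r" "\<lambda>x. r * a x"] that closed(1,3) by simp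
    then show ?thesis using le[OF that] that(1) by (simp add: field_simps)
  qed
  have scale: "\<phi> (\<lambda>x. r * a x) = r * \<phi> a" if "a \<in> C" for r a
  proof (cases r "0 :: real" rule: linorder_cases)
    case less
    then show ?thesis
      using scale_nn[of "-r" "a"] minus[OF mult[OF const[of "- r"] that]] that by simp
  qed (use that scale_nn cst[of 0] in auto)
  have sq0: "\<phi> (\<lambda>x. (c x)\<^sup>2) = 0" if c: "c \<in> C" "\<phi> c = 0" for c
  proof (rule antisym)
    show "0 \<le> \<phi> (\<lambda>x. (c x)\<^sup>2)"
      by (intro nn qm_sos[OF P] sums_of_squares.square c)
    have "\<phi> (\<lambda>x. (c x)\<^sup>2) \<le> e\<^sup>2" if e: "e > 0" for e
    proof -
      \<comment> \<open>The product is \<open>(c + e) * (e - c) = e^2 - c^2\<close>. Its factors add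
        up to \<open>2 * e\<close>, and both are members because
        \<open>-e < \<phi> c < e\<close>.\<close>
      have "(\<lambda>x. (c x - - e) * (2 * e - (c x - - e))) \<in> P"
        using e c inl[of "-e" c] inu[of c e] by (intro qm_mult_complement[OF P]) auto
      then show ?thesis
        using c by (intro upper power2) (auto simp: algebra_simps power2_eq_square)
    qed
    then have "\<phi> (\<lambda>x. (c x)\<^sup>2) \<le> e" if "e > 0" for e
      using that by (metis real_sqrt_gt_zero real_sqrt_pow2 less_imp_le)
    then show "\<phi> (\<lambda>x. (c x)\<^sup>2) \<le> 0" by (rule dense_ge)
  qed
  have sq: "\<phi> (\<lambda>x. (c x)\<^sup>2) = (\<phi> c)\<^sup>2" if c: "c \<in> C" for c
  proof -
    define d where "d = (\<lambda>x. c x + - \<phi> c)"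
    have d: "d \<in> C" "\<phi> d = 0"
      unfolding d_def using add[OF c const[of "- \<phi> c"]] hom_add[OF c const[of "- \<phi> c"]] cst by simp_all
    have "\<phi> (\<lambda>x. (c x)\<^sup>2) = \<phi> (\<lambda>x. (d x)\<^sup>2 + (2 * \<phi> c * d x + (\<phi> c)\<^sup>2))"
      by (rule arg_cong[of _ _ \<phi>]) (simp add: d_def fun_eq_iff power2_eq_square algebra_simps)
    also have "\<dots> = (\<phi> c)\<^sup>2"
      using d by (simp add: hom_add scale cst sq0 closed)
    finally show ?thesis .
  qed
  have hom_mult: "\<phi> (\<lambda>x. a x * b x) = \<phi> a * \<phi> b" if "a \<in> C" "b \<in> C" for a b
  proof -
    have "\<phi> (\<lambda>x. (a x + b x)\<^sup>2) = \<phi> (\<lambda>x. ((a x)\<^sup>2 + (b x)\<^sup>2) + 2 * (a x * b x))"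
      by (rule arg_cong[of _ _ \<phi>]) (simp add: fun_eq_iff power2_eq_square algebra_simps)
    also have "\<dots> = (\<phi> a)\<^sup>2 + (\<phi> b)\<^sup>2 + 2 * \<phi> (\<lambda>x. a x * b x)"
      using that by (simp add: hom_add scale sq closed)
    finally show ?thesis
      unfolding sq[OF add[OF that]] hom_add[OF that] by (simp add: power2_sum)
  qed
  show ?thesis using that cst hom_add hom_mult nn by blast
qed

text \<open>Adjoining \<open>-f\<close> yields \<open>\<phi> (-f) \<ge> 0\<close>. The enlarged
  module stays proper: \<open>-1 = q - s f\<close> would make \<open>s f - 1\<close> a member of
  \<open>Q\<close>, and that already puts \<open>f\<close> into \<open>Q\<close>.\<close>

theorem archimedean_representation:
  assumes Q: "quadratic_module C Q" and arch: "\<And>c. c \<in> C \<Longrightarrow> \<exists>k. (\<lambda>x. k - c x) \<in> Q"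
    and f: "f \<in> C" "f \<notin> Q"
  obtains \<phi> where "\<And>r. \<phi> (\<lambda>_. r) = r"
    "\<And>a b. a \<in> C \<Longrightarrow> b \<in> C \<Longrightarrow> \<phi> (\<lambda>x. a x + b x) = \<phi> a + \<phi> b"
    "\<And>a b. a \<in> C \<Longrightarrow> b \<in> C \<Longrightarrow> \<phi> (\<lambda>x. a x * b x) = \<phi> a * \<phi> b"
    "\<And>a. a \<in> Q \<Longrightarrow> \<phi> a \<ge> (0 :: real)" "\<phi> f \<le> 0"
proof -
  let ?Q' = "{\<lambda>x. q x + s x * - f x |q s. q \<in> Q \<and> s \<in> sums_of_squares C}"
  note Q' = qm_adjoin[OF Q uminus[OF f(1)]]
  have "(\<lambda>_. -1) \<notin> ?Q'"
  proof
    assume "(\<lambda>_. -1) \<in> ?Q'"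
    then obtain q s where qs: "q \<in> Q" "s \<in> sums_of_squares C" and eq: "(\<lambda>_. -1) = (\<lambda>x. q x + s x * - f x)"
      by blast
    have "q = (\<lambda>x. s x * f x - 1)"
    proof
      fix x show "q x = s x * f x - 1" using fun_cong[OF eq, of x] by simp
    qed
    with mem_qm_of_sos_mult[OF Q arch f(1) qs(2)] qs(1) f(2) show False by simp
  qed
  from ex_maximal_qm[OF Q'(1) this]
  obtain P where P: "quadratic_module C P" "(\<lambda>_. -1) \<notin> P" "?Q' \<subseteq> P"
    "\<forall>P'. quadratic_module C P' \<longrightarrow> (\<lambda>_. -1) \<notin> P' \<longrightarrow> P \<subseteq> P' \<longrightarrow> P' = P"
    by (elim exE conjE)
  have archP: "\<exists>k. (\<lambda>x. k - c x) \<in> P" if "c \<in> C" for c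
    using arch[OF that] Q'(2) P(3) by blast
  from ex_character_of_maximal_qm[OF P(1,2) archP maximal_qm_total[OF P(1,2) P(4)[rule_format]]]
  obtain \<phi> where \<phi>: "\<And>r. \<phi> (\<lambda>_. r) = r"
    "\<And>a b. a \<in> C \<Longrightarrow> b \<in> C \<Longrightarrow> \<phi> (\<lambda>x. a x + b x) = \<phi> a + \<phi> b"
    "\<And>a b. a \<in> C \<Longrightarrow> b \<in> C \<Longrightarrow> \<phi> (\<lambda>x. a x * b x) = \<phi> a * \<phi> b"
    "\<And>a. a \<in> P \<Longrightarrow> \<phi> a \<ge> (0 :: real)" by blast
  have "0 \<le> \<phi> (\<lambda>x. - f x)" using \<phi>(4) Q'(3) P(3) by blast
  also have "\<dots> = - \<phi> f" using \<phi>(2)[OF f(1) uminus[OF f(1)]] \<phi>(1)[of 0] by simp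
  finally have "\<phi> f \<le> 0" by simp
  then show ?thesis
    using \<phi>(4) subset_trans[OF Q'(2) P(3)] by (intro that[of \<phi>] \<phi>(1-3)) blast+
qed

end

section \<open>Evaluation and involution\<close>

lemma qpoly_induct [case_names single add]:
  fixes p :: "'n qpoly"
  assumes "\<And>w c. P (Poly_Mapping.single w c)" and "\<And>p q. P p \<Longrightarrow> P q \<Longrightarrow> P (p + q)"
  shows "P p"
proof (induction p rule: update_induct)
  case const
  then show ?case using assms(1)[of 0 0] by simp
next
  case (update f a b)
  then have "Poly_Mapping.update a b f = Poly_Mapping.single a b + f"
    by (intro poly_mapping_eqI) (auto simp: lookup_update lookup_add lookup_single in_keys_iff when_def)
  then show ?case using assms update by simp
qed

lemma sum_keys_superset:
  fixes F :: "'n qword \<Rightarrow> real \<Rightarrow> 'b::comm_monoid_add"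
  assumes "\<And>w. F w 0 = 0" "finite S" "Poly_Mapping.keys p \<subseteq> S"
  shows "(\<Sum>w\<in>Poly_Mapping.keys p. F w (Poly_Mapping.lookup p w)) = (\<Sum>w\<in>S. F w (Poly_Mapping.lookup p w))"
  using assms by (intro sum.mono_neutral_left) (auto simp: in_keys_iff)

text \<open>Cancellation can make the support of \<open>p + q\<close> smaller than the union of the
  supports; over the union, the extra terms have coefficient zero.\<close>

lemma sum_keys_add:
  fixes F :: "'n qword \<Rightarrow> real \<Rightarrow> 'b::comm_monoid_add"
  assumes "\<And>w. F w 0 = 0" "\<And>w c d. F w (c + d) = F w c + F w d"
  shows "(\<Sum>w\<in>Poly_Mapping.keys (p + q). F w (Poly_Mapping.lookup (p + q) w)) =
    (\<Sum>w\<in>Poly_Mapping.keys p. F w (Poly_Mapping.lookup p w)) +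
    (\<Sum>w\<in>Poly_Mapping.keys q. F w (Poly_Mapping.lookup q w))"
proof -
  let ?S = "Poly_Mapping.keys p \<union> Poly_Mapping.keys q"
  have "Poly_Mapping.keys (p + q) \<subseteq> ?S" by (rule keys_add)
  then show ?thesis
    using assms
    by (subst (1 2 3) sum_keys_superset[where S = ?S]) (auto simp: lookup_add sum.distrib)
qed

lemma qeval_single [simp]: "qeval a (Poly_Mapping.single w c) = c *\<^sub>R eval_word a w"
  by (simp add: qeval_def)

lemma qeval_add [simp]: "qeval a (p + q) = qeval a p + qeval a q"
  unfolding qeval_def by (rule sum_keys_add) (auto simp: scaleR_add_left)

lemma qeval_0 [simp]: "qeval a 0 = 0"
  by (simp add: qeval_def)

lemma eval_word_0 [simp]: "eval_word a 0 = 1"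
  by transfer simp

lemma eval_word_add: "eval_word a (u + v) = eval_word a u * eval_word a v"
  by transfer simp

lemma qeval_1 [simp]: "qeval a 1 = 1"
  by (simp flip: single_one)

lemma qeval_mult [simp]: "qeval a (p * q) = qeval a p * qeval a q"
proof (induction p rule: qpoly_induct)
  case (single v c)
  show ?case
    by (induction q rule: qpoly_induct) (simp_all add: mult_single eval_word_add distrib_left)
qed (simp add: distrib_right)

lemma qeval_uminus [simp]: "qeval a (- p) = - qeval a p"
  using qeval_add[of a p "- p"] by (simp add: eq_neg_iff_add_eq_0 add.commute)

lemma qeval_diff [simp]: "qeval a (p - q) = qeval a p - qeval a q"
  using qeval_add[of a p "- q"] by simp

lemma qeval_sum [simp]: "qeval a (sum f S) = (\<Sum>i\<in>S. qeval a (f i))"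
  by (induction S rule: infinite_finite_induct) auto

lemma qeval_qconst [simp]: "qeval a (qconst r) = of_real r"
  by (simp add: qconst_def of_real_def)

lemma qeval_qvar [simp]: "qeval a (qvar i) = a $ i" "qeval a (qvar_bar i) = qcnj (a $ i)"
proof -
  have "eval_word a (letter_word x) = eval_letter a x" for x by transfer simp
  then show "qeval a (qvar i) = a $ i" "qeval a (qvar_bar i) = qcnj (a $ i)"
    by (simp_all add: qvar_def qvar_bar_def)
qed

lemma qstar_single [simp]: "qstar (Poly_Mapping.single w c) = Poly_Mapping.single (qword_star w) c"
  by (simp add: qstar_def)

lemma qstar_add [simp]: "qstar (p + q) = qstar p + qstar q"
  unfolding qstar_def by (rule sum_keys_add) (auto simp: single_add)

lemma qword_star_add: "qword_star (u + v) = qword_star v + qword_star u"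
  by transfer (simp add: word_star_def)

lemma qword_star_star [simp]: "qword_star (qword_star w) = w"
  by transfer (simp add: word_star_def rev_map comp_def)

lemma qstar_mult [simp]: "qstar (p * q) = qstar q * qstar p"
proof (induction p rule: qpoly_induct)
  case (single v c)
  show ?case
    by (induction q rule: qpoly_induct)
       (simp_all add: mult_single qword_star_add distrib_left distrib_right mult.commute)
qed (simp add: distrib_left distrib_right)

lemma qstar_qstar [simp]: "qstar (qstar p) = p"
  by (induction p rule: qpoly_induct) auto

lemma qword_star_0 [simp]: "qword_star 0 = 0"
  by transfer (simp add: word_star_def)

lemma qstar_0 [simp]: "qstar 0 = 0"
  by (simp add: qstar_def)

lemma qstar_1 [simp]: "qstar 1 = 1"
  by (simp flip: single_one)

lemma qstar_uminus [simp]: "qstar (- p) = - qstar p"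
  using qstar_add[of p "- p"] by (simp add: eq_neg_iff_add_eq_0 add.commute)

lemma qstar_diff [simp]: "qstar (p - q) = qstar p - qstar q"
  using qstar_add[of p "- q"] by simp

lemma qstar_sum [simp]: "qstar (sum f S) = (\<Sum>i\<in>S. qstar (f i))"
  by (induction S rule: infinite_finite_induct) auto

lemma qstar_qconst [simp]: "qstar (qconst r) = qconst r"
  by (simp add: qconst_def)

lemma eval_word_star: "eval_word a (qword_star w) = qcnj (eval_word a w)"
proof (transfer, unfold word_star_def)
  fix a :: "quat ^ 'n" and w
  have "eval_letter a (cletter x) = qcnj (eval_letter a x)" for x by (cases x) auto
  then show "prod_list (map (eval_letter a) (rev (map cletter w))) =
      qcnj (prod_list (map (eval_letter a) w))"
    by (induction w) (auto simp: qcnj_mult)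
qed

lemma qeval_qstar [simp]: "qeval a (qstar p) = qcnj (qeval a p)"
  by (induction p rule: qpoly_induct) (auto simp: eval_word_star qcnj_scaleR qcnj_add)

lemma qconst_mult: "qconst (r * s) = qconst r * qconst s"
  by (simp add: qconst_def mult_single)

lemma qconst_1 [simp]: "qconst 1 = 1"
  by (simp add: qconst_def)

lemma qconst_0 [simp]: "qconst 0 = 0"
  by (simp add: qconst_def)

section \<open>Components, trace and norm of quaternions\<close>

lemma quat_sel_simps [simp]:
  "qre (x + y) = qre x + qre y" "qi (x + y) = qi x + qi y" "qj (x + y) = qj x + qj y" "qk (x + y) = qk x + qk y"
  "qre (x - y) = qre x - qre y" "qi (x - y) = qi x - qi y" "qj (x - y) = qj x - qj y" "qk (x - y) = qk x - qk y"
  "qre (- x) = - qre x" "qi (- x) = - qi x" "qj (- x) = - qj x" "qk (- x) = - qk x"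
  "qre (r *\<^sub>R x) = r * qre x" "qi (r *\<^sub>R x) = r * qi x" "qj (r *\<^sub>R x) = r * qj x" "qk (r *\<^sub>R x) = r * qk x"
  "qre 0 = 0" "qi 0 = 0" "qj 0 = 0" "qk 0 = 0"
  "qre 1 = 1" "qi 1 = 0" "qj 1 = 0" "qk 1 = 0"
  "qre (of_real r) = r" "qi (of_real r) = 0" "qj (of_real r) = 0" "qk (of_real r) = 0"
  by (simp_all add: quat_defs of_real_def)

lemma quat_numeral_sel [simp]:
  "qre (numeral k) = numeral k" "qi (numeral k) = 0" "qj (numeral k) = 0" "qk (numeral k) = 0"
proof -
  have *: "numeral k = (of_real (numeral k) :: quat)" by simp
  show "qre (numeral k) = numeral k" "qi (numeral k) = 0" "qj (numeral k) = 0" "qk (numeral k) = 0"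
    unfolding * quat_sel_simps by (rule refl)+
qed

lemma quat_mult_sel:
  "qre (x * y) = qre x * qre y - qi x * qi y - qj x * qj y - qk x * qk y"
  "qi (x * y) = qre x * qi y + qi x * qre y + qj x * qk y - qk x * qj y"
  "qj (x * y) = qre x * qj y - qi x * qk y + qj x * qre y + qk x * qi y"
  "qk (x * y) = qre x * qk y + qi x * qj y - qj x * qi y + qk x * qre y"
  by (simp_all add: times_quat_def)

lemma qre_sum [simp]: "qre (sum f S) = (\<Sum>i\<in>S. qre (f i))"
  by (induction S rule: infinite_finite_induct) auto

text \<open>The real part is half the reduced trace, hence cyclic. Later moves of a factor from one
  end of a product to the other rest on this.\<close>

lemma qre_mult_commute: "qre (x * y) = qre (y * x)"
  by (simp add: quat_mult_sel algebra_simps)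

text \<open>Euler's four-square identity, the source of the multiplicativity of
  \<open>N\<close>.\<close>

lemma qnorm2_mult: "qnorm2 (x * y) = qnorm2 x * qnorm2 y"
  by (simp add: qnorm2_def quat_mult_sel power2_eq_square algebra_simps)

lemma qre_qcnj_mult: "qre (qcnj x * x) = qnorm2 x" "qre (x * qcnj x) = qnorm2 x"
  by (simp_all add: mult_qcnj)

lemma qnorm2_qcnj [simp]: "qnorm2 (qcnj x) = qnorm2 x"
  by (simp add: qnorm2_def)

lemma qnorm2_le_0: "qnorm2 x \<le> 0 \<Longrightarrow> x = 0"
proof -
  assume "qnorm2 x \<le> 0"
  then have "(qre x)\<^sup>2 = 0 \<and> (qi x)\<^sup>2 = 0 \<and> (qj x)\<^sup>2 = 0 \<and> (qk x)\<^sup>2 = 0"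
    using zero_le_power2[of "qre x"] zero_le_power2[of "qi x"] zero_le_power2[of "qj x"] zero_le_power2[of "qk x"]
    unfolding qnorm2_def by linarith
  then show ?thesis by (simp add: quat_eq_iff)
qed

lemma quat_eq_of_real_iff: "qcnj x = x \<longleftrightarrow> x = of_real (qre x)"
  by (auto simp: quat_eq_iff)

lemma qeval_Sym: "p \<in> Sym \<Longrightarrow> qeval a p = of_real (qre (qeval a p))"
  using qeval_qstar[of a p] quat_eq_of_real_iff[of "qeval a p"] by (auto simp: Sym_def)

section \<open>Positive characters are point evaluations\<close>

text \<open>\<open>Re p * Re q\<close> is in general not \<open>Re (p * q)\<close>, so
  \<open>T_mult\<close> accepts any \<open>s\<close> whose real part is that product. Its case
  \<open>q = 1\<close> also shows that \<open>T p\<close> depends only on the real part of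
  \<open>p\<close>.\<close>

locale positive_character =
  fixes T :: "'n::finite qpoly \<Rightarrow> real"
  assumes T_const: "T (qconst r) = r"
    and T_add: "T (p + q) = T p + T q"
    and T_mult: "(\<And>a. qre (qeval a s) = qre (qeval a p) * qre (qeval a q)) \<Longrightarrow> T s = T p * T q"
    and T_nonneg: "0 \<le> T (qstar p * p)"
begin

lemma T_cong: "(\<And>a. qre (qeval a p) = qre (qeval a q)) \<Longrightarrow> T p = T q"
  using T_mult[of p q 1] T_const[of 1] by simp

lemma T_scale: "T (qconst c * p) = c * T p"
  using T_mult[of "qconst c * p" "qconst c" p] by (simp add: T_const quat_mult_sel)

lemma T_0 [simp]: "T 0 = 0"
  using T_const[of 0] by simp

lemma T_1 [simp]: "T 1 = 1"
  using T_const[of 1] by simp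

lemma T_uminus: "T (- p) = - T p"
  using T_add[of p "- p"] by simp

lemma T_diff: "T (p - q) = T p - T q"
  using T_add[of p "- q"] by (simp add: T_uminus)

lemma T_commute: "T (p * q) = T (q * p)"
  by (rule T_cong) (simp add: qre_mult_commute)

lemma T_qstar: "T (qstar p) = T p"
  by (rule T_cong) simp

abbreviation N :: "'n qpoly \<Rightarrow> real" where
  "N p \<equiv> T (qstar p * p)"

lemma N_mult: "N (p * q) = N p * N q"
  by (rule T_mult) (simp add: qre_qcnj_mult qnorm2_mult flip: qcnj_mult)

lemma N_scale: "N (qconst c * p) = c\<^sup>2 * N p"
  using N_mult[of "qconst c" p] by (simp add: T_const power2_eq_square flip: qconst_mult)

text \<open>Pointwise, \<open>|z|^2 - (Re z)^2 = |z - qcnj z|^2 / 4\<close>. For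
  \<open>z = p * q\<close> this reduces the inequality to \<open>N ?d \<ge> 0\<close> and the
  multiplicativity of \<open>N\<close>; \<open>?u\<close> evaluates to \<open>Re z\<close>, so
  \<open>?u * ?u\<close> represents the square of the real part.\<close>

lemma Cauchy_Schwarz: "(T (p * q))\<^sup>2 \<le> N p * N q"
proof -
  let ?d = "p * q - qstar (p * q)" and ?u = "qconst (1 / 2) * (p * q + qstar (p * q))"
  have half: "qre ((of_real c * (z + qcnj z)) * (of_real c * (z + qcnj z))) = (2 * c)\<^sup>2 * (qre z * qre z)"
    for c z
    by (simp add: quat_mult_sel power2_eq_square)
  have skew: "qnorm2 (z - qcnj z) = 4 * (qnorm2 z - qre z * qre z)" for z
    by (simp add: quat_mult_sel qnorm2_def power2_eq_square)
  have sq: "T (?u * ?u) = T (p * q) * T (p * q)"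
    by (rule T_mult, unfold qeval_mult[of _ ?u] qeval_mult[of _ "qconst (1 / 2)"] qeval_add qeval_qstar qeval_qconst half) simp
  have "T (qstar ?d * ?d + qconst 4 * (?u * ?u)) = T (qconst 4 * (qstar (p * q) * (p * q)))"
  proof (rule T_cong)
    fix a
    have "qre (of_real r * x) = r * qre x" for r x by (simp add: quat_mult_sel)
    then show "qre (qeval a (qstar ?d * ?d + qconst 4 * (?u * ?u))) =
        qre (qeval a (qconst 4 * (qstar (p * q) * (p * q))))"
      by (simp only: qeval_add qeval_mult qeval_diff qeval_qstar qeval_qconst quat_sel_simps half skew
          qre_qcnj_mult) (simp add: power2_eq_square)
  qed
  then have "N ?d + 4 * (T (p * q) * T (p * q)) = 4 * N (p * q)"
    by (simp only: T_add T_scale sq)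
  then show ?thesis
    using T_nonneg[of ?d] N_mult[of p q] by (simp add: power2_eq_square)
qed

lemma T_null: "N p = 0 \<Longrightarrow> T (p * q) = 0"
  using Cauchy_Schwarz[of p q] by simp

text \<open>Modulo the null space of \<^term>\<open>N\<close>, the elements killed by \<^term>\<open>T\<close> behave like purely
  imaginary quaternions; since the null space is an ideal, each relation holds under \<^term>\<open>T\<close>
  after multiplication by an arbitrary \<open>r\<close>.\<close>

lemma imaginary_qstar:
  assumes "T x = 0"
  shows "T (qstar x * r) = - T (x * r)"
proof -
  \<comment> \<open>\<open>x + qstar x\<close> evaluates to the real number \<open>2 * Re x\<close>,
    so its norm is the square of a real part.\<close>
  have "N (x + qstar x) = T (qconst 2 * x) * T (qconst 2 * x)"
    by (rule T_mult) (simp add: quat_mult_sel)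
  then have "N (x + qstar x) = 0" using assms by (simp add: T_scale)
  then show ?thesis using T_null[of "x + qstar x" r] by (simp add: distrib_right T_add)
qed

lemma imaginary_square:
  assumes "T x = 0"
  shows "T (x * (x * r)) = - N x * T r"
proof -
  have "T (qstar x * (x * r)) = N x * T r"
    by (rule T_mult) (simp add: mult_qcnj quat_mult_sel flip: mult.assoc)
  then show ?thesis using imaginary_qstar[OF assms, of "x * r"] by simp
qed

text \<open>Modulo null elements \<open>x\<close>, \<open>y\<close> and \<open>x * y\<close> all
  change sign under the involution, hence
  \<open>- x * y = qstar (x * y) = qstar y * qstar x = y * x\<close>. Each starred factor is rotated
  to the front before its sign is changed.\<close>

lemma imaginary_anticommute:
  assumes "T x = 0" "T y = 0" "T (x * y) = 0"
  shows "T (y * (x * r)) = - T (x * (y * r))"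
proof -
  have "T (qstar (x * y) * r) = T (qstar y * (qstar x * r))" by (simp add: mult.assoc)
  also have "\<dots> = - T (qstar x * (r * y))"
    by (simp add: imaginary_qstar assms T_commute[of y] mult.assoc)
  also have "\<dots> = T (y * (x * r))"
    by (simp add: imaginary_qstar assms T_commute[of y] mult.assoc)
  finally show ?thesis using imaginary_qstar[OF assms(3), of r] by (simp add: mult.assoc)
qed

text \<open>\<open>P\<close> will mean imaginary, or imaginary and orthogonal to \<open>e1\<close>.
  The flag \<open>\<epsilon>\<close> records whether a unit element exists, with \<open>0\<close> as
  the default \<open>e\<close>, so that real, complex and quaternionic quotients share one
  computation.\<close>

lemma ex_unit_or_null:
  assumes "P 0" "\<And>c x. P x \<Longrightarrow> P (qconst c * x)"
  shows "\<exists>e \<epsilon>. P e \<and> N e = \<epsilon> \<and> (\<epsilon> = 1 \<or> \<epsilon> = 0 \<and> (\<forall>x. P x \<longrightarrow> N x = 0))"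
proof (cases "\<forall>x. P x \<longrightarrow> N x = 0")
  case False
  then obtain x where x: "P x" "N x \<noteq> 0" by blast
  then have "N (qconst (1 / sqrt (N x)) * x) = 1"
    using T_nonneg[of x] by (subst N_scale) (simp add: power_divide)
  then show ?thesis using assms(2)[OF x(1)] by blast
qed (use assms(1) in \<open>auto intro!: exI[of _ 0]\<close>)

text \<open>The proof is that of Frobenius' theorem: modulo null elements the algebra is spanned by
  \<open>1, e1, e2, e1 * e2\<close>, where \<open>e1\<close> and \<open>e2\<close> are orthonormal imaginary elements; if there are
  not enough of them, the missing ones are taken to be zero, and \<open>W\<close> is the subalgebra of
  quaternions without the corresponding components.\<close>

theorem ex_point: "\<exists>b. \<forall>p. T p = qre (qeval b p)"
proof -
  have "\<exists>e \<epsilon>. T e = 0 \<and> N e = \<epsilon> \<and> (\<epsilon> = 1 \<or> \<epsilon> = 0 \<and> (\<forall>x. T x = 0 \<longrightarrow> N x = 0))"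
    by (rule ex_unit_or_null) (auto simp: T_scale)
  then obtain e1 \<epsilon>1 where e1: "T e1 = 0" "N e1 = \<epsilon>1"
    and \<epsilon>1: "\<epsilon>1 = 1 \<or> \<epsilon>1 = 0 \<and> (\<forall>x. T x = 0 \<longrightarrow> N x = 0)" by blast
  have scale1: "T (e1 * (qconst c * x)) = c * T (e1 * x)" for c x
    by (simp add: T_commute[of e1] T_scale mult.assoc)
  have "\<exists>e \<epsilon>. (T e = 0 \<and> T (e1 * e) = 0) \<and> N e = \<epsilon> \<and>
      (\<epsilon> = 1 \<or> \<epsilon> = 0 \<and> (\<forall>x. T x = 0 \<and> T (e1 * x) = 0 \<longrightarrow> N x = 0))"
    by (rule ex_unit_or_null) (auto simp: T_scale scale1)
  then obtain e2 \<epsilon>2 where e2: "T e2 = 0" "T (e1 * e2) = 0" "N e2 = \<epsilon>2"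
    and \<epsilon>2: "\<epsilon>2 = 1 \<or> \<epsilon>2 = 0 \<and> (\<forall>x. T x = 0 \<and> T (e1 * x) = 0 \<longrightarrow> N x = 0)" by blast
  have rot: "T (s * (p * r)) = T (p * (r * s))" for s p r
    using T_commute[of s "p * r"] by (simp add: mult.assoc)
  have 11: "T (e1 * (e1 * r)) = - \<epsilon>1 * T r" for r
    using imaginary_square[OF e1(1)] e1(2) by simp
  have 22: "T (e2 * (e2 * r)) = - \<epsilon>2 * T r" for r
    using imaginary_square[OF e2(1)] e2(3) by simp
  have 21: "T (e2 * (e1 * r)) = - T (e1 * (e2 * r))" for r
    using imaginary_anticommute[OF e1(1) e2(1,2)] .
  \<comment> \<open>In these words the cyclic shift \<open>rot\<close> first brings the factors to
    be simplified to the front.\<close>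
  have 122: "T (e1 * (e2 * (e2 * r))) = - \<epsilon>2 * T (e1 * r)" for r
    using rot[of e1 e2 "e2 * r"] rot[of e1 1 r] 22[of "r * e1"] by (simp add: mult.assoc)
  have 121: "T (e1 * (e2 * (e1 * r))) = \<epsilon>1 * T (e2 * r)" for r
    using rot[of e1 e2 "e1 * r"] 21[of "r * e1"] rot[of e1 e1 "e2 * r"] 11[of "e2 * r"]
    by (simp add: mult.assoc)
  note table = 11 22 21 122 121
  have table1: "T (e1 * e1) = - \<epsilon>1" "T (e2 * e2) = - \<epsilon>2" "T (e2 * e1) = 0"
    "T (e1 * (e2 * e2)) = 0" "T (e1 * (e2 * e1)) = 0"
    using 11[of 1] 22[of 1] 21[of 1] 122[of 1] 121[of 1] e1 e2 by simp_all
  have N12: "N (e1 * e2) = \<epsilon>1 * \<epsilon>2" using N_mult e1(2) e2(3) by simp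
  \<comment> \<open>A vanishing flag means a null element, so in that case both sides are
    zero.\<close>
  have null1: "T (p * e1) * \<epsilon>1 = T (p * e1)" for p
    using \<epsilon>1 T_null[of e1 p] e1(2) by (auto simp: T_commute[of p])
  have null2: "T (p * e2) * \<epsilon>2 = T (p * e2)" for p
    using \<epsilon>2 T_null[of e2 p] e2(3) by (auto simp: T_commute[of p])
  have null12: "T (p * (e1 * e2)) * (\<epsilon>1 * \<epsilon>2) = T (p * (e1 * e2))" for p
    using \<epsilon>1 \<epsilon>2 T_null[of "e1 * e2" p] N12 by (auto simp: T_commute[of p])
  have complete: "N r = 0"
    if r: "T r = 0" "T (r * e1) = 0" "T (r * e2) = 0" "T (r * (e1 * e2)) = 0" for r
  proof (cases "\<epsilon>1 = 1 \<and> \<epsilon>2 = 1")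
    case True
    have r': "T (e1 * r) = 0" "T (e2 * r) = 0" "T (e1 * (e2 * r)) = 0"
      using r T_commute[of r e1] T_commute[of r e2] T_commute[of r "e1 * e2"]
      by (simp_all add: mult.assoc)
    \<comment> \<open>\<open>r\<close> anticommutes with \<open>e1\<close>, \<open>e2\<close> and
      \<open>e1 * e2\<close>. Passing the first two in turn costs two signs, passing their product
      at once costs one, so the value equals its own negative.\<close>
    have "T (r * (e1 * (e2 * s))) = 0" for s
    proof -
      have "T (r * (e1 * (e2 * s))) = - T (e1 * (r * (e2 * s)))"
        by (rule imaginary_anticommute) (use e1 r r' in auto)
      also have "\<dots> = - T (r * (e2 * (s * e1)))"
        using rot[of e1 r "e2 * s"] by (simp add: mult.assoc)
      also have "\<dots> = T (e2 * (r * (s * e1)))"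
        using imaginary_anticommute[of e2 r "s * e1"] e2 r r' by simp
      also have "\<dots> = T (e1 * (e2 * (r * s)))"
        using rot[of e1 e2 "r * s"] by (simp add: mult.assoc)
      also have "\<dots> = - T (r * (e1 * (e2 * s)))"
        using imaginary_anticommute[of r "e1 * e2" s] e2 r r' by (simp add: mult.assoc)
      finally show ?thesis by simp
    qed
    from this[of "qstar (r * (e1 * e2))"] have "N (r * (e1 * e2)) = 0"
      using T_commute[of "qstar (r * (e1 * e2))"] by (simp add: mult.assoc)
    then show ?thesis using N_mult[of r "e1 * e2"] N12 True by simp
  next
    case False
    then show ?thesis using \<epsilon>1 \<epsilon>2 r T_commute[of r e1] by auto
  qed
  define lift where "lift x = qconst (qre x) + qconst (qi x) * e1 + qconst (qj x) * e2 +
    qconst (qk x) * (e1 * e2)" for x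
  define W where "W = {x. qi x * \<epsilon>1 = qi x \<and> qj x * \<epsilon>2 = qj x \<and> qk x * (\<epsilon>1 * \<epsilon>2) = qk x}"
  have T_lift: "T (lift x * r) = qre x * T r + qi x * T (e1 * r) + qj x * T (e2 * r) +
      qk x * T (e1 * (e2 * r))" for x r
    unfolding lift_def by (simp add: distrib_right T_add T_scale mult.assoc)
  have \<epsilon>01: "\<epsilon>1 = 0 \<or> \<epsilon>1 = 1" "\<epsilon>2 = 0 \<or> \<epsilon>2 = 1" using \<epsilon>1 \<epsilon>2 by auto
  have W_mult: "x * y \<in> W" if "x \<in> W" "y \<in> W" for x y
    using that \<epsilon>01 by (auto simp: W_def quat_mult_sel)
  have W_qcnj: "qcnj x \<in> W" if "x \<in> W" for x
    using that by (auto simp: W_def)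
  \<comment> \<open>Membership in \<open>W\<close> matters: if \<open>\<epsilon>1 = 0\<close>, then
    \<open>e1\<close> is null, while the quaternion unit lifted to it still squares to
    \<open>-1\<close>.\<close>
  have lift_mult: "T (lift x * (lift y * r)) = T (lift (x * y) * r)" if "x \<in> W" "y \<in> W" for x y r
  proof -
    have T_lift': "T (s * (lift y * r)) = qre y * T (s * r) + qi y * T (s * (e1 * r)) +
        qj y * T (s * (e2 * r)) + qk y * T (s * (e1 * (e2 * r)))" for s
      by (simp only: rot[of s "lift y" r] rot[of s e1 r] rot[of s e2 r] rot[of s e1 "e2 * r"]
          T_commute[of s r] T_lift mult.assoc)
    have T_lift'': "T (e1 * (e2 * (lift y * r))) = qre y * T (e1 * (e2 * r)) + qi y * T (e1 * (e2 * (e1 * r))) +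
        qj y * T (e1 * (e2 * (e2 * r))) + qk y * T (e1 * (e2 * (e1 * (e2 * r))))"
      using T_lift'[of "e1 * e2"] by (simp add: mult.assoc)
    show ?thesis
      unfolding T_lift[of _ "lift y * r"] T_lift[of y r] T_lift[of "x * y"] T_lift'' T_lift'[of e1] T_lift'[of e2]
      unfolding table
      using that \<epsilon>01 by (elim disjE) (auto simp: W_def quat_mult_sel algebra_simps)
  qed
  have lift_qstar: "T (qstar (lift x) * r) = T (lift (qcnj x) * r)" for x r
  proof -
    have scale: "T (qstar (qconst c * p) * r) = c * T (qstar p * r)" for c p
      by (simp add: T_scale mult.assoc T_commute[of "qstar p"])
    have "T (qstar (lift x) * r) = qre x * T r + qi x * T (qstar e1 * r) + qj x * T (qstar e2 * r)
        + qk x * T (qstar (e1 * e2) * r)"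
      unfolding lift_def qstar_add distrib_right T_add scale by (simp add: T_scale)
    also have "\<dots> = T (lift (qcnj x) * r)"
      unfolding T_lift imaginary_qstar[OF e1(1)] imaginary_qstar[OF e2(1)] imaginary_qstar[OF e2(2)]
      by (simp add: mult.assoc)
    finally show ?thesis .
  qed
  \<comment> \<open>Coordinates with respect to \<open>1, e1, e2, e1 * e2\<close>. The minus signs
    come from pairing with \<open>qstar e1\<close>, \<open>qstar e2\<close> and
    \<open>qstar (e1 * e2)\<close>, which agree with the negatives of the unstarred elements modulo
    null elements.\<close>
  define \<psi> where "\<psi> p = Quat (T p) (- T (p * e1)) (- T (p * e2)) (- T (p * (e1 * e2)))" for p
  have \<psi>_W: "\<psi> p \<in> W" for p
    using null1[of p] null2[of p] null12[of p] by (simp add: W_def \<psi>_def)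
  have \<psi>: "T (p * r) = T (lift (\<psi> p) * r)" for p r
  proof -
    have "N (p - lift (\<psi> p)) = 0"
    proof (rule complete)
      show "T (p - lift (\<psi> p)) = 0"
        using T_lift[of "\<psi> p" 1] e1 e2 by (simp add: T_diff \<psi>_def)
      show "T ((p - lift (\<psi> p)) * e1) = 0"
        using e1 e2 by (simp add: left_diff_distrib T_diff T_lift \<psi>_def table1 null1)
      show "T ((p - lift (\<psi> p)) * e2) = 0"
        using e1 e2 by (simp add: left_diff_distrib T_diff T_lift \<psi>_def table1 null2)
      show "T ((p - lift (\<psi> p)) * (e1 * e2)) = 0"
        using e1 e2 table null12[of p]
        by (simp add: left_diff_distrib T_diff T_lift \<psi>_def table1)
    qed
    then show ?thesis using T_null[of "p - lift (\<psi> p)" r] by (simp add: left_diff_distrib T_diff)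
  qed
  define b where "b = (\<chi> i. \<psi> (qvar i))"
  have letter: "eval_letter b x \<in> W \<and>
      (\<forall>r. T (Poly_Mapping.single (letter_word x) 1 * r) = T (lift (eval_letter b x) * r))" for x
  proof (cases x)
    case (Ltr i)
    then show ?thesis using \<psi>_W \<psi> by (simp add: b_def flip: qvar_def)
  next
    case (CLtr i)
    have bar: "Poly_Mapping.single (letter_word (CLtr i)) 1 = qstar (qvar i)"
    proof -
      have "qword_star (letter_word (Ltr i)) = letter_word (CLtr i)"
        by transfer (simp add: word_star_def)
      then show ?thesis by (simp add: qvar_def)
    qed
    have "T (qstar (qvar i) * r) = T (qstar (lift (\<psi> (qvar i))) * r)" for r
    proof -
      have "T (qstar (qvar i) * r) = T (qvar i * qstar r)"
        using T_qstar[of "qstar (qvar i) * r"] T_commute by simp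
      also have "\<dots> = T (lift (\<psi> (qvar i)) * qstar r)" by (rule \<psi>)
      also have "\<dots> = T (qstar (lift (\<psi> (qvar i))) * r)"
        using T_qstar[of "lift (\<psi> (qvar i)) * qstar r"] T_commute by simp
      finally show ?thesis .
    qed
    then show ?thesis using CLtr W_qcnj[OF \<psi>_W] by (simp add: b_def bar lift_qstar)
  qed
  have word: "eval_word b (abs_qword u) \<in> W \<and>
      (\<forall>r. T (Poly_Mapping.single (abs_qword u) 1 * r) = T (lift (eval_word b (abs_qword u)) * r))" for u
  proof (induction u)
    case Nil
    have "abs_qword [] = (0 :: 'n qword)" by (simp add: zero_qword_def)
    then show ?case by (simp add: W_def lift_def)
  next
    case (Cons x u)
    have "abs_qword (x # u) = letter_word x + abs_qword u"
      by (simp add: letter_word.abs_eq plus_qword.abs_eq)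
    moreover have "eval_word b (letter_word x) = eval_letter b x"
      by transfer simp
    ultimately have ev: "eval_word b (abs_qword (x # u)) = eval_letter b x * eval_word b (abs_qword u)"
      and single: "Poly_Mapping.single (abs_qword (x # u)) (1::real) =
        Poly_Mapping.single (letter_word x) 1 * Poly_Mapping.single (abs_qword u) 1"
      by (simp_all add: eval_word_add mult_single)
    have "T (Poly_Mapping.single (abs_qword (x # u)) 1 * r) =
        T (lift (eval_word b (abs_qword (x # u))) * r)" for r
    proof -
      let ?w = "Poly_Mapping.single (abs_qword u) (1::real)" and ?e = "lift (eval_letter b x)"
      have "T (Poly_Mapping.single (abs_qword (x # u)) 1 * r) = T (?e * (?w * r))"
        using letter[of x] by (simp add: single mult.assoc)
      \<comment> \<open>The induction hypothesis concerns a leading word, so \<open>?w\<close> is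
        rotated to the front, with \<open>r * ?e\<close> as the trailing factor.\<close>
      also have "\<dots> = T (lift (eval_word b (abs_qword u)) * (r * ?e))"
        using Cons rot[of ?e ?w r] by simp
      also have "\<dots> = T (?e * (lift (eval_word b (abs_qword u)) * r))"
        by (rule rot[symmetric])
      also have "\<dots> = T (lift (eval_word b (abs_qword (x # u))) * r)"
        unfolding ev using Cons letter[of x] by (intro lift_mult) auto
      finally show ?thesis .
    qed
    then show ?case using W_mult[of "eval_letter b x"] Cons letter[of x] by (simp add: ev)
  qed
  have "T p = qre (qeval b p)" for p
  proof (induction p rule: qpoly_induct)
    case (single w c)
    obtain u where u: "w = abs_qword u"
      using qword.abs_induct[of "\<lambda>w. \<exists>u. w = abs_qword u"] by blast
    have "Poly_Mapping.single w c = qconst c * Poly_Mapping.single w 1"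
      by (simp add: qconst_def mult_single)
    then have "T (Poly_Mapping.single w c) = c * T (Poly_Mapping.single w 1 * 1)"
      by (simp add: T_scale)
    also have "\<dots> = c * T (lift (eval_word b w) * 1)"
      using word[of u] unfolding u by presburger
    also have "\<dots> = c * qre (eval_word b w)"
      unfolding T_lift using e1 e2 by simp
    finally show ?case by simp
  qed (simp add: T_add)
  then show ?thesis by blast
qed

end

section \<open>The quadratic module of real parts\<close>

lemma SOS_add_square: "\<sigma> \<in> SOS \<Longrightarrow> \<sigma> + qstar p * p \<in> SOS"
proof -
  assume "\<sigma> \<in> SOS"
  then obtain k :: nat and q where "\<sigma> = (\<Sum>s<k. qstar (q s) * q s)" unfolding SOS_def by blast
  then have "\<sigma> + qstar p * p = (\<Sum>s<Suc k. qstar ((q(k := p)) s) * (q(k := p)) s)" by simp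
  then show ?thesis unfolding SOS_def by blast
qed

lemma SOS_0: "0 \<in> SOS"
  unfolding SOS_def by (intro CollectI exI[of _ 0]) simp

lemma SOS_square: "qstar p * p \<in> SOS"
  using SOS_add_square[OF SOS_0] by simp

lemma SOS_1: "1 \<in> SOS"
  using SOS_square[of 1] by simp

lemma SOS_induct [consumes 1, case_names zero add_square]:
  assumes "\<sigma> \<in> SOS" "P 0" "\<And>\<sigma> p. \<sigma> \<in> SOS \<Longrightarrow> P \<sigma> \<Longrightarrow> P (\<sigma> + qstar p * p)"
  shows "P \<sigma>"
proof -
  obtain k :: nat and q where \<sigma>: "\<sigma> = (\<Sum>s<k. qstar (q s) * q s)" using assms(1) unfolding SOS_def by blast
  have "(\<Sum>s<k. qstar (q s) * q s) \<in> SOS \<and> P (\<Sum>s<k. qstar (q s) * q s)"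
    by (induction k) (simp_all add: assms SOS_0 SOS_add_square)
  then show ?thesis using \<sigma> by simp
qed

lemma SOS_add: "\<tau> \<in> SOS \<Longrightarrow> \<sigma> \<in> SOS \<Longrightarrow> \<sigma> + \<tau> \<in> SOS"
  by (induction rule: SOS_induct) (auto simp: SOS_add_square simp flip: add.assoc)

lemma SOS_conjugate: "\<sigma> \<in> SOS \<Longrightarrow> qstar p * \<sigma> * p \<in> SOS"
proof (induction rule: SOS_induct)
  case (add_square \<sigma> q)
  then show ?case using SOS_add_square[of "qstar p * \<sigma> * p" "q * p"]
    by (simp add: distrib_left distrib_right mult.assoc)
qed (simp add: SOS_0)

lemma SOS_Sym: "\<sigma> \<in> SOS \<Longrightarrow> \<sigma> \<in> Sym"
  by (induction rule: SOS_induct) (auto simp: Sym_def)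

section \<open>Real parts as an algebra of functions\<close>

definition real_part :: "'n::finite qpoly \<Rightarrow> quat ^ 'n \<Rightarrow> real" where
  "real_part p a = qre (qeval a p)"

lemma qre_mult_of_real: "qre (of_real r * x) = r * qre x" "qre (x * of_real r) = r * qre x"
  by (simp_all add: quat_mult_sel)

lemma real_part_simps [simp]:
  "real_part (p + q) a = real_part p a + real_part q a"
  "real_part (p - q) a = real_part p a - real_part q a"
  "real_part (- p) a = - real_part p a"
  "real_part 0 a = 0" "real_part 1 a = 1"
  "real_part (qconst r) a = r"
  "real_part (qconst r * p) a = r * real_part p a"
  "real_part (sum f S) a = (\<Sum>i\<in>S. real_part (f i) a)"
  by (simp_all add: real_part_def qre_mult_of_real)

text \<open>Half of \<open>p + qstar p\<close> evaluates to the real number \<open>Re p\<close>, so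
  \<open>Re p * Re q\<close> is the real part of its product with \<open>q\<close>.\<close>

lemma function_algebra_real_part: "function_algebra (range real_part)"
proof
  show "(\<lambda>_. r) \<in> range real_part" for r
    by (rule range_eqI[of _ _ "qconst r"]) (simp add: fun_eq_iff)
next
  fix a b :: "quat ^ 'n \<Rightarrow> real"
  assume "a \<in> range real_part" "b \<in> range real_part"
  then obtain p q where pq: "a = real_part p" "b = real_part q" by auto
  show "(\<lambda>x. a x + b x) \<in> range real_part"
    by (rule range_eqI[of _ _ "p + q"]) (simp add: fun_eq_iff pq)
  have "real_part ((p + qstar p) * q) x = 2 * (real_part p x * real_part q x)" for x
    by (simp add: real_part_def quat_mult_sel)
  then show "(\<lambda>x. a x * b x) \<in> range real_part"
    by (intro range_eqI[of _ _ "qconst (1 / 2) * ((p + qstar p) * q)"]) (simp add: fun_eq_iff pq)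
qed

lemma qeval_SOS_real: "\<sigma> \<in> SOS \<Longrightarrow> qeval a \<sigma> = of_real (real_part \<sigma> a)"
  using qeval_Sym[OF SOS_Sym] by (simp add: real_part_def)

lemma real_part_SOS_conjugate:
  "\<sigma> \<in> SOS \<Longrightarrow> real_part (qstar q * \<sigma> * q * p) a = qnorm2 (qeval a q) * real_part (\<sigma> * p) a"
proof -
  assume \<sigma>: "\<sigma> \<in> SOS"
  have "qeval a (qstar q * \<sigma> * q) = of_real (qnorm2 (qeval a q)) * of_real (real_part \<sigma> a)"
    using qeval_SOS_real[OF \<sigma>, of a] by (simp add: mult.assoc of_real_quat_commute mult_qcnj flip: mult_qcnj(2))
  then show ?thesis
    unfolding real_part_def qeval_mult[of a _ p]
    by (simp add: qeval_SOS_real[OF \<sigma>] mult.assoc qre_mult_of_real)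
qed

text \<open>Real parts of products are invariant under cyclic permutation, so under \<^const>\<open>real_part\<close>
  the terms of the quadratic module collapse to one-sided ones.\<close>

definition real_module :: "nat \<Rightarrow> (nat \<Rightarrow> 'n::finite qpoly) \<Rightarrow> nat \<Rightarrow> (nat \<Rightarrow> 'n qpoly) \<Rightarrow> (quat ^ 'n \<Rightarrow> real) set" where
  "real_module m g l h =
    {real_part (\<sigma> 0 + (\<Sum>i\<in>{1..m}. \<sigma> i * g i) + (\<Sum>j\<in>{1..l}. p j * h j)) |\<sigma> p. \<forall>i\<in>{0..m}. \<sigma> i \<in> SOS}"

lemma real_part_quad_module:
  assumes "u \<in> quad_module m g l h"
  shows "real_part u \<in> real_module m g l h"
proof -
  obtain \<sigma> \<tau> \<nu> and N :: "nat \<Rightarrow> nat" where \<sigma>: "\<forall>i\<in>{0..m}. \<sigma> i \<in> SOS"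
    and u: "u = \<sigma> 0 + qconst (1/2) * (\<Sum>i\<in>{1..m}. \<sigma> i * g i + g i * \<sigma> i)
        + (\<Sum>j\<in>{1..l}. \<Sum>\<alpha><N j. \<tau> j \<alpha> * h j * \<nu> j \<alpha>
             + qstar (\<nu> j \<alpha>) * qstar (h j) * qstar (\<tau> j \<alpha>))"
    using assms(1) unfolding quad_module_def by blast
  have cyc: "real_part (p * q) a = real_part (q * p) a" for p q and a :: "quat ^ 'a"
    by (simp add: real_part_def qre_mult_commute)
  have star: "real_part (qstar p) a = real_part p a" for p and a :: "quat ^ 'a"
    by (simp add: real_part_def)
  have h: "real_part (t * h j * n + qstar n * qstar (h j) * qstar t) a = 2 * real_part (n * t * h j) a"
    for t n j a
    using star[of "t * h j * n" a] cyc[of "t * h j" n a] by (simp add: mult.assoc)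
  have g: "real_part (\<sigma> i * g i + g i * \<sigma> i) a = 2 * real_part (\<sigma> i * g i) a" for i a
    using cyc[of "g i" "\<sigma> i" a] by simp
  have "real_part u = real_part (\<sigma> 0 + (\<Sum>i\<in>{1..m}. \<sigma> i * g i) +
      (\<Sum>j\<in>{1..l}. (\<Sum>\<alpha><N j. qconst 2 * (\<nu> j \<alpha> * \<tau> j \<alpha>)) * h j))"
  proof
    fix a
    show "real_part u a = real_part (\<sigma> 0 + (\<Sum>i\<in>{1..m}. \<sigma> i * g i) +
      (\<Sum>j\<in>{1..l}. (\<Sum>\<alpha><N j. qconst 2 * (\<nu> j \<alpha> * \<tau> j \<alpha>)) * h j)) a"
      unfolding u real_part_simps(1,7,8) real_part_simps(8)[where S = "{..<_}"] sum_distrib_right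
      unfolding real_part_simps(1)[symmetric] g h
      by (simp add: mult.assoc sum_distrib_left)
  qed
  then show ?thesis
    unfolding real_module_def using \<sigma>
    by (intro CollectI exI[of _ \<sigma>] exI[of _ "\<lambda>j. \<Sum>\<alpha><N j. qconst 2 * (\<nu> j \<alpha> * \<tau> j \<alpha>)"] conjI)
qed

lemma quad_module_Sym:
  assumes "u \<in> quad_module m g l h" "\<forall>i\<in>{1..m}. g i \<in> Sym"
  shows "u \<in> Sym"
proof -
  obtain \<sigma> \<tau> \<nu> and N :: "nat \<Rightarrow> nat" where \<sigma>: "\<forall>i\<in>{0..m}. \<sigma> i \<in> SOS"
    and u: "u = \<sigma> 0 + qconst (1/2) * (\<Sum>i\<in>{1..m}. \<sigma> i * g i + g i * \<sigma> i)
        + (\<Sum>j\<in>{1..l}. \<Sum>\<alpha><N j. \<tau> j \<alpha> * h j * \<nu> j \<alpha>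
             + qstar (\<nu> j \<alpha>) * qstar (h j) * qstar (\<tau> j \<alpha>))"
    using assms(1) unfolding quad_module_def by blast
  have \<sigma>s: "qstar (\<sigma> i) = \<sigma> i" if "i \<in> {0..m}" for i
    using SOS_Sym[OF bspec[OF \<sigma> that]] by (simp add: Sym_def)
  have central: "qconst r * p = p * qconst r" for r and p :: "'a qpoly"
    by (induction p rule: qpoly_induct) (simp_all add: qconst_def mult_single distrib_left distrib_right mult.commute)
  have "qstar (\<Sum>i\<in>{1..m}. \<sigma> i * g i + g i * \<sigma> i) = (\<Sum>i\<in>{1..m}. \<sigma> i * g i + g i * \<sigma> i)"
    unfolding qstar_sum using assms(2) by (intro sum.cong) (auto simp: \<sigma>s Sym_def add.commute)
  moreover have "qstar (\<Sum>j\<in>{1..l}. \<Sum>\<alpha><N j. \<tau> j \<alpha> * h j * \<nu> j \<alpha>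
             + qstar (\<nu> j \<alpha>) * qstar (h j) * qstar (\<tau> j \<alpha>)) =
     (\<Sum>j\<in>{1..l}. \<Sum>\<alpha><N j. \<tau> j \<alpha> * h j * \<nu> j \<alpha>
             + qstar (\<nu> j \<alpha>) * qstar (h j) * qstar (\<tau> j \<alpha>))"
    unfolding qstar_sum by (intro sum.cong) (auto simp: add.commute mult.assoc)
  ultimately show ?thesis
    unfolding u Sym_def mem_Collect_eq qstar_add qstar_mult qstar_qconst
    by (simp only: \<sigma>s central) (simp add: \<sigma>s)
qed

lemma real_module_quad_module:
  assumes "F \<in> real_module m g l h"
  shows "\<exists>u\<in>quad_module m g l h. F = real_part u"
proof -
  obtain \<sigma> p where \<sigma>: "\<forall>i\<in>{0..m}. \<sigma> i \<in> SOS"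
    and F: "F = real_part (\<sigma> 0 + (\<Sum>i\<in>{1..m}. \<sigma> i * g i) + (\<Sum>j\<in>{1..l}. p j * h j))"
    using assms unfolding real_module_def by auto
  \<comment> \<open>A term and its adjoint have the same real part, so one summand per
    \<open>j\<close>, with coefficient \<open>p j / 2\<close> and \<open>\<nu> = 1\<close>, recovers
    the real part of \<open>p j * h j\<close>.\<close>
  define u where "u = \<sigma> 0 + qconst (1/2) * (\<Sum>i\<in>{1..m}. \<sigma> i * g i + g i * \<sigma> i)
        + (\<Sum>j\<in>{1..l}. \<Sum>\<alpha><(1::nat). (qconst (1/2) * p j) * h j * 1
             + qstar 1 * qstar (h j) * qstar (qconst (1/2) * p j))"
  have "u \<in> quad_module m g l h"
    unfolding u_def quad_module_def using \<sigma>
    by (intro CollectI exI[of _ \<sigma>] exI[of _ "\<lambda>_. 1"] exI[of _ "\<lambda>j _. qconst (1/2) * p j"] exI[of _ "\<lambda>_ _. 1"] conjI) simp_all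
  moreover have "real_part u = F"
  proof
    fix a
    have g: "real_part (\<sigma> i * g i + g i * \<sigma> i) a = 2 * real_part (\<sigma> i * g i) a" for i
      by (simp add: real_part_def qre_mult_commute[of "qeval a (g i)"])
    have star: "real_part (qstar p) a = real_part p a" for p
      by (simp add: real_part_def)
    have h: "real_part ((qconst (1/2) * p j) * h j * 1 + qstar 1 * qstar (h j) * qstar (qconst (1/2) * p j)) a =
        real_part (p j * h j) a" for j
      using star[of "qconst (1/2) * p j * h j"] by (simp add: mult.assoc)
    show "real_part u a = F a"
      unfolding u_def F real_part_simps(1,7,8) real_part_simps(8)[where S = "{..<_}"]
      unfolding real_part_simps(1)[symmetric] g h by (simp add: sum_distrib_left)
  qed
  ultimately show ?thesis by blast
qed

text \<open>Each \<open>\<sigma> i\<close> may be conjugated to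
  \<open>qstar q * \<sigma> i * q\<close>, which is stronger than multiplying by squares of real
  parts. This bounds products of letters and gives \<open>T_nonneg\<close> for the
  character.\<close>

lemma real_module_norm_mult:
  assumes "F \<in> real_module m g l h"
  shows "(\<lambda>a. qnorm2 (qeval a q) * F a) \<in> real_module m g l h"
proof -
  obtain \<sigma> p where \<sigma>: "\<forall>i\<in>{0..m}. \<sigma> i \<in> SOS"
    and F: "F = real_part (\<sigma> 0 + (\<Sum>i\<in>{1..m}. \<sigma> i * g i) + (\<Sum>j\<in>{1..l}. p j * h j))"
    using assms unfolding real_module_def by auto
  have "(\<lambda>a. qnorm2 (qeval a q) * F a) = real_part (qstar q * \<sigma> 0 * q +
      (\<Sum>i\<in>{1..m}. (qstar q * \<sigma> i * q) * g i) + (\<Sum>j\<in>{1..l}. (qstar q * q * p j) * h j))"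
  proof
    fix a
    have "real_part (qstar q * \<sigma> 0 * q) a = qnorm2 (qeval a q) * real_part (\<sigma> 0) a"
      using real_part_SOS_conjugate[of "\<sigma> 0" q 1] \<sigma> by simp
    moreover have "real_part (qstar q * q * p j * h j) a = qnorm2 (qeval a q) * real_part (p j * h j) a" for j
      by (simp add: real_part_def mult_qcnj mult.assoc[of "of_real _"] qre_mult_of_real)
    moreover have "(\<Sum>i\<in>{1..m}. real_part (qstar q * \<sigma> i * q * g i) a) =
        (\<Sum>i\<in>{1..m}. qnorm2 (qeval a q) * real_part (\<sigma> i * g i) a)"
      using \<sigma> by (intro sum.cong real_part_SOS_conjugate) auto
    ultimately show "qnorm2 (qeval a q) * F a = real_part (qstar q * \<sigma> 0 * q +
      (\<Sum>i\<in>{1..m}. (qstar q * \<sigma> i * q) * g i) + (\<Sum>j\<in>{1..l}. (qstar q * q * p j) * h j)) a"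
      unfolding F by (simp add: distrib_left sum_distrib_left)
  qed
  then show ?thesis
    unfolding real_module_def using \<sigma> SOS_conjugate
    by (intro CollectI exI[of _ "\<lambda>i. qstar q * \<sigma> i * q"] exI[of _ "\<lambda>j. qstar q * q * p j"]) auto
qed

lemma quadratic_module_real_module: "quadratic_module (range real_part) (real_module m g l h)"
  unfolding quadratic_module_def
proof (intro conjI ballI)
  show "real_module m g l h \<subseteq> range real_part"
    unfolding real_module_def by auto
  have "(\<lambda>_. 1) = real_part ((if (0::nat) = 0 then 1 else 0) + (\<Sum>i\<in>{1..m}. (if i = 0 then 1 else 0) * g i)
      + (\<Sum>j\<in>{1..l}. 0 * h j))"
    by (auto simp: fun_eq_iff)
  then show "(\<lambda>_. 1) \<in> real_module m g l h"
    unfolding real_module_def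
    by (intro CollectI exI[of _ "\<lambda>i. if i = 0 then 1 else 0"] exI[of _ "\<lambda>_. 0"]) (auto simp: SOS_0 SOS_1)
next
  fix a b assume "a \<in> real_module m g l h" "b \<in> real_module m g l h"
  then obtain \<sigma> p \<tau> q where \<sigma>: "\<forall>i\<in>{0..m}. \<sigma> i \<in> SOS" "\<forall>i\<in>{0..m}. \<tau> i \<in> SOS"
    and ab: "a = real_part (\<sigma> 0 + (\<Sum>i\<in>{1..m}. \<sigma> i * g i) + (\<Sum>j\<in>{1..l}. p j * h j))"
     "b = real_part (\<tau> 0 + (\<Sum>i\<in>{1..m}. \<tau> i * g i) + (\<Sum>j\<in>{1..l}. q j * h j))"
    unfolding real_module_def by blast
  have "(\<lambda>x. a x + b x) = real_part ((\<sigma> 0 + \<tau> 0) + (\<Sum>i\<in>{1..m}. (\<sigma> i + \<tau> i) * g i) + (\<Sum>j\<in>{1..l}. (p j + q j) * h j))"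
    unfolding ab by (simp add: fun_eq_iff distrib_right sum.distrib)
  then show "(\<lambda>x. a x + b x) \<in> real_module m g l h"
    unfolding real_module_def using \<sigma> SOS_add
    by (intro CollectI exI[of _ "\<lambda>i. \<sigma> i + \<tau> i"] exI[of _ "\<lambda>j. p j + q j"]) auto
next
  fix c a :: "quat ^ 'a \<Rightarrow> real" assume "c \<in> range real_part" and a: "a \<in> real_module m g l h"
  then obtain p where p: "c = real_part p" by blast
  \<comment> \<open>The square \<open>c^2\<close> is the norm of the symmetrization of
    \<open>p\<close>, so stability under norms covers it.\<close>
  have "qnorm2 (qeval x (qconst (1/2) * (p + qstar p))) = (c x)\<^sup>2" for x
  proof -
    have "of_real r * (z + qcnj z) = of_real (2 * r * qre z)" for r z
      by (simp add: quat_eq_iff quat_mult_sel)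
    from this[of "1/2" "qeval x p"] have "qeval x (qconst (1/2) * (p + qstar p)) = of_real (c x)"
      unfolding p real_part_def qeval_mult qeval_add qeval_qstar qeval_qconst by simp
    then show ?thesis by (simp add: qnorm2_def)
  qed
  then show "(\<lambda>x. (c x)\<^sup>2 * a x) \<in> real_module m g l h"
    using real_module_norm_mult[OF a, of "qconst (1/2) * (p + qstar p)"] by simp
qed

lemma real_part_mult_h_mem:
  assumes "j \<in> {1..l}"
  shows "real_part (p * h j) \<in> real_module m g l h"
proof -
  have "real_part (p * h j) = real_part (0 + (\<Sum>i\<in>{1..m}. 0 * g i) + (\<Sum>k\<in>{1..l}. (if k = j then p else 0) * h k))"
    using assms by (simp add: if_distrib[of "\<lambda>x. x * _"] cong: if_cong)
  then show ?thesis
    unfolding real_module_def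
    by (intro CollectI exI[of _ "\<lambda>_. 0"] exI[of _ "\<lambda>k. if k = j then p else 0"]) (auto simp: SOS_0)
qed

lemma real_part_g_mem:
  assumes "i \<in> {1..m}"
  shows "real_part (g i) \<in> real_module m g l h"
proof -
  let ?\<sigma> = "\<lambda>k. if k = i then 1 else 0"
  have "real_part (g i) = real_part (?\<sigma> 0 + (\<Sum>k\<in>{1..m}. ?\<sigma> k * g k) + (\<Sum>j\<in>{1..l}. 0 * h j))"
    using assms by (simp add: if_distrib[of "\<lambda>x. x * _"] cong: if_cong)
  then show ?thesis
    unfolding real_module_def
    by (intro CollectI exI[of _ ?\<sigma>] exI[of _ "\<lambda>_. 0"]) (auto simp: SOS_0 SOS_1)
qed

text \<open>The elements of bounded norm form a subalgebra \<open>B\<close> stable under the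
  involution, and \<open>B\<close> contains the letters. Norms are bounded instead of real parts
  because they are multiplicative.\<close>

lemma real_module_archimedean:
  assumes arch: "archimedean (quad_module m g l h)" and c: "c \<in> range real_part"
  shows "\<exists>k. (\<lambda>a. k - c a) \<in> real_module m g l h"
proof -
  let ?M = "real_module m g l h"
  interpret function_algebra "range real_part"
    by (rule function_algebra_real_part)
  note qm = quadratic_module_real_module[of m g l h]
  note M_add = qm_add[OF qm] and M_const = qm_const[OF qm] and M_scale = qm_scale[OF qm]
  have norm: "(\<lambda>a. qnorm2 (qeval a p)) \<in> ?M" for p
    using real_module_norm_mult[OF qm_one[OF qm]] by simp
  define B where "B = {p. \<exists>k\<ge>0. (\<lambda>a. k - qnorm2 (qeval a p)) \<in> ?M}"
  have BI: "p \<in> B" if "(\<lambda>a. k - qnorm2 (qeval a p)) \<in> ?M" for k p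
  proof -
    have "(\<lambda>a. max k 0 - qnorm2 (qeval a p)) \<in> ?M"
      using M_add[OF that M_const[of "max k 0 - k"]] by simp
    then show ?thesis unfolding B_def by (intro CollectI exI[of _ "max k 0"]) simp
  qed
  have B_mult: "p * q \<in> B" if pq: "p \<in> B" "q \<in> B" for p q
  proof -
    obtain k1 k2 where k: "k1 \<ge> 0" "(\<lambda>a. k1 - qnorm2 (qeval a p)) \<in> ?M" "(\<lambda>a. k2 - qnorm2 (qeval a q)) \<in> ?M"
      using pq unfolding B_def by blast
    \<comment> \<open>The sum telescopes to \<open>k1 * k2 - |p|^2 * |q|^2\<close>.\<close>
    have "(\<lambda>a. qnorm2 (qeval a q) * (k1 - qnorm2 (qeval a p)) + k1 * (k2 - qnorm2 (qeval a q))) \<in> ?M"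
      by (rule M_add[OF real_module_norm_mult[OF k(2)] M_scale[OF k(1,3)]])
    then show ?thesis
      by (intro BI[of "k1 * k2"]) (simp add: qnorm2_mult algebra_simps)
  qed
  have B_add: "p + q \<in> B" if pq: "p \<in> B" "q \<in> B" for p q
  proof -
    obtain k1 k2 where k: "(\<lambda>a. k1 - qnorm2 (qeval a p)) \<in> ?M" "(\<lambda>a. k2 - qnorm2 (qeval a q)) \<in> ?M"
      using pq unfolding B_def by blast
    \<comment> \<open>Parallelogram law:
      \<open>|p + q|^2 + |p - q|^2 = 2 * |p|^2 + 2 * |q|^2\<close>.\<close>
    have "(\<lambda>a. 2 * (k1 - qnorm2 (qeval a p)) + 2 * (k2 - qnorm2 (qeval a q)) + qnorm2 (qeval a (p - q))) \<in> ?M"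
      using k by (intro M_add M_scale norm) auto
    then show ?thesis
      by (intro BI[of "2 * k1 + 2 * k2"]) (simp add: qnorm2_def power2_eq_square algebra_simps)
  qed
  have B_const: "qconst r \<in> B" for r
    using M_const[of 0] by (intro BI[of "r\<^sup>2"]) (simp add: qnorm2_def)
  obtain R where "qconst R - (\<Sum>i\<in>UNIV. qvar i * qvar_bar i) \<in> quad_module m g l h"
    using arch unfolding archimedean_def by blast
  from real_part_quad_module[OF this]
  have R: "real_part (qconst R - (\<Sum>i\<in>UNIV. qvar i * qvar_bar i)) \<in> ?M" .
  have B_var: "qvar i \<in> B" for i
  proof -
    have sum: "(\<lambda>a. \<Sum>j\<in>S. qnorm2 (qeval a (qvar j))) \<in> ?M" if "finite S" for S
      using that
    proof (induction S rule: finite_induct)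
      case (insert x S)
      then show ?case using M_add[OF norm[of "qvar x"] insert.IH] by simp
    qed (use M_const[of 0] in simp)
    \<comment> \<open>Adding back the norms of the other letters isolates the letter
      \<open>i\<close>.\<close>
    have "(\<lambda>a. real_part (qconst R - (\<Sum>i\<in>UNIV. qvar i * qvar_bar i)) a +
        (\<Sum>j\<in>UNIV - {i}. qnorm2 (qeval a (qvar j)))) \<in> ?M"
      by (intro M_add R sum) simp
    also have "(\<lambda>a. real_part (qconst R - (\<Sum>i\<in>UNIV. qvar i * qvar_bar i)) a +
        (\<Sum>j\<in>UNIV - {i}. qnorm2 (qeval a (qvar j)))) = (\<lambda>a. R - qnorm2 (qeval a (qvar i)))"
    proof
      fix a :: "quat ^ 'a"
      have "real_part (qconst R - (\<Sum>i\<in>UNIV. qvar i * qvar_bar i)) a = R - (\<Sum>j\<in>UNIV. qnorm2 (qeval a (qvar j)))"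
        by (simp add: real_part_def qre_qcnj_mult)
      then show "real_part (qconst R - (\<Sum>i\<in>UNIV. qvar i * qvar_bar i)) a +
          (\<Sum>j\<in>UNIV - {i}. qnorm2 (qeval a (qvar j))) = R - qnorm2 (qeval a (qvar i))"
        by (simp add: sum.remove[of UNIV i])
    qed
    finally show ?thesis by (rule BI)
  qed
  have B_star: "qstar p \<in> B" if "p \<in> B" for p
    using that unfolding B_def by simp
  have B_letter: "Poly_Mapping.single (letter_word x) 1 \<in> B" for x
  proof (cases x)
    case (Ltr i)
    then show ?thesis using B_var by (simp add: qvar_def)
  next
    case (CLtr i)
    have "qword_star (letter_word (Ltr i)) = letter_word (CLtr i)"
      by transfer (simp add: word_star_def)
    then show ?thesis using B_star[OF B_var[of i]] CLtr by (simp add: qvar_def)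
  qed
  have B_word: "Poly_Mapping.single (abs_qword u) 1 \<in> B" for u
  proof (induction u)
    case Nil
    then show ?case using B_const[of 1] by (simp add: qconst_def zero_qword_def)
  next
    case (Cons x u)
    have "abs_qword (x # u) = letter_word x + abs_qword u"
      by (simp add: letter_word.abs_eq plus_qword.abs_eq)
    then show ?case using B_mult[OF B_letter[of x] Cons] by (simp add: mult_single)
  qed
  have B_all: "p \<in> B" for p
  proof (induction p rule: qpoly_induct)
    case (single w c)
    obtain u where u: "w = abs_qword u"
      using qword.abs_induct[of "\<lambda>w. \<exists>u. w = abs_qword u"] by blast
    show ?case using B_mult[OF B_const[of c] B_word[of u]] by (simp add: u qconst_def mult_single)
  qed (rule B_add)
  obtain p where p: "c = real_part p" using c by blast
  obtain k where k: "(\<lambda>a. k - qnorm2 (qeval a p)) \<in> ?M" using B_all[of p] unfolding B_def by blast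
  \<comment> \<open>Membership of \<open>|p - 1|^2\<close> amounts to
    \<open>2 * Re p \<le> |p|^2 + 1\<close>, which turns the bound on the norm into one on the real
    part.\<close>
  have "(\<lambda>a. (1 / 2) * ((k - qnorm2 (qeval a p)) + qnorm2 (qeval a (p - 1)))) \<in> ?M"
    by (intro M_scale M_add k norm) simp
  also have "(\<lambda>a. (1 / 2) * ((k - qnorm2 (qeval a p)) + qnorm2 (qeval a (p - 1)))) = (\<lambda>a. (k + 1) / 2 - c a)"
    by (simp add: p fun_eq_iff real_part_def qnorm2_def power2_eq_square field_simps)
  finally show ?thesis by blast
qed

theorem real_part_mem_real_module:
  assumes f: "f \<in> Sym" and g: "\<forall>i\<in>{1..m}. g i \<in> Sym"
    and arch: "archimedean (quad_module m g l h)"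
    and pos: "\<forall>a\<in>semialg_set m g l h. 0 < qeval a f"
  shows "real_part f \<in> real_module m g l h"
proof (rule ccontr)
  assume neg: "real_part f \<notin> real_module m g l h"
  interpret function_algebra "range real_part"
    by (rule function_algebra_real_part)
  note qm = quadratic_module_real_module[of m g l h]
  obtain \<phi> where const: "\<And>r. \<phi> (\<lambda>_. r) = r"
    and add: "\<And>a b. a \<in> range real_part \<Longrightarrow> b \<in> range real_part \<Longrightarrow> \<phi> (\<lambda>x. a x + b x) = \<phi> a + \<phi> b"
    and mult: "\<And>a b. a \<in> range real_part \<Longrightarrow> b \<in> range real_part \<Longrightarrow> \<phi> (\<lambda>x. a x * b x) = \<phi> a * \<phi> b"
    and nonneg: "\<And>a. a \<in> real_module m g l h \<Longrightarrow> \<phi> a \<ge> 0" and f0: "\<phi> (real_part f) \<le> 0"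
    using archimedean_representation[OF qm real_module_archimedean[OF arch] rangeI neg] by blast
  interpret positive_character "\<lambda>p. \<phi> (real_part p)"
  proof
    show "\<phi> (real_part (qconst r)) = r" for r
      using const[of r] by (simp add: real_part_def[abs_def])
    show "\<phi> (real_part (p + q)) = \<phi> (real_part p) + \<phi> (real_part q)" for p q
      using add[of "real_part p" "real_part q"] by (simp add: real_part_def[abs_def])
    show "\<phi> (real_part s) = \<phi> (real_part p) * \<phi> (real_part q)"
      if "\<And>a. qre (qeval a s) = qre (qeval a p) * qre (qeval a q)" for s p q
      using mult[of "real_part p" "real_part q"] that by (simp add: real_part_def[abs_def])
    show "0 \<le> \<phi> (real_part (qstar p * p))" for p
      using nonneg[OF real_module_norm_mult[OF qm_one[OF qm], of p]]
      by (simp add: real_part_def[abs_def] qre_qcnj_mult)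
  qed
  obtain b where b: "\<And>p. \<phi> (real_part p) = qre (qeval b p)"
    using ex_point by blast
  have "b \<in> semialg_set m g l h"
    unfolding semialg_set_def
  proof (intro CollectI conjI ballI)
    fix i assume i: "i \<in> {1..m}"
    then have "0 \<le> qre (qeval b (g i))"
      using nonneg[OF real_part_g_mem[OF i]] b by simp
    then show "0 \<le> qeval b (g i)"
      using qeval_Sym[of "g i" b] g i by (metis less_eq_quat_def quat_sel_simps)
  next
    fix j assume j: "j \<in> {1..l}"
    have "0 \<le> qre (qeval b (p * h j))" for p
      using nonneg[OF real_part_mult_h_mem[OF j]] b by simp
    \<comment> \<open>The coefficient of \<open>h j\<close> is arbitrary; this choice turns
      nonnegativity into \<open>- |h j|^2 \<ge> 0\<close> at \<open>b\<close>.\<close>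
    from this[of "- qstar (h j)"] have "qnorm2 (qeval b (h j)) \<le> 0"
      by (simp add: qre_qcnj_mult)
    then show "qeval b (h j) = 0" by (rule qnorm2_le_0)
  qed
  then have "0 < qre (qeval b f)" using pos by (auto simp: less_quat_def)
  then show False using f0 b by simp
qed

text \<open>Some \<open>u\<close> in the module has the same real part as \<open>f\<close>. Both are
  symmetric, hence real-valued, so \<open>f - u\<close> vanishes at every point.\<close>

lemma positivstellensatz_free:
  assumes f: "f \<in> Sym" and g: "\<forall>i\<in>{1..m}. g i \<in> Sym"
    and arch: "archimedean (quad_module m g l h)"
    and pos: "\<forall>a\<in>semialg_set m g l h. 0 < qeval a f"
  shows "\<exists>u\<in>quad_module m g l h. \<exists>v\<in>Sym \<inter> vanishing_ideal. f = u + v"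
proof -
  obtain u where u: "u \<in> quad_module m g l h" "real_part f = real_part u"
    using real_module_quad_module[OF real_part_mem_real_module[OF assms]] by blast
  have "f - u \<in> Sym"
    using f quad_module_Sym[OF u(1) g] by (simp add: Sym_def)
  moreover have "qeval a (f - u) = 0" for a
    using qeval_Sym[OF f, of a] qeval_Sym[OF quad_module_Sym[OF u(1) g], of a] u(2)
    by (simp add: real_part_def[abs_def] fun_eq_iff)
  ultimately show ?thesis
    using u(1) by (intro bexI[of _ u] bexI[of _ "f - u"]) (auto simp: vanishing_ideal_def)
qed

section \<open>The quotient algebras\<close>

lemma free_alg_simps [simp]:
  "carrier free_alg = UNIV" "x \<otimes>\<^bsub>free_alg\<^esub> y = x * y" "\<one>\<^bsub>free_alg\<^esub> = 1"
  "\<zero>\<^bsub>free_alg\<^esub> = 0" "x \<oplus>\<^bsub>free_alg\<^esub> y = x + y"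
  by (simp_all add: free_alg_def)

lemma ring_free_alg: "ring (free_alg :: 'n qpoly ring)"
proof (rule ringI)
  show "abelian_group (free_alg :: 'n qpoly ring)"
  proof (rule abelian_groupI)
    fix x :: "'n qpoly"
    show "\<exists>y\<in>carrier free_alg. y \<oplus>\<^bsub>free_alg\<^esub> x = \<zero>\<^bsub>free_alg\<^esub>"
      by (rule bexI[of _ "- x"]) simp_all
  qed (simp_all add: ac_simps)
  show "Group.monoid (free_alg :: 'n qpoly ring)"
    by (rule monoidI) (simp_all add: mult.assoc)
qed (simp_all add: distrib_left distrib_right)

lemma ideal_vanishing: "ideal vanishing_ideal (free_alg :: 'n::finite qpoly ring)"
proof (rule idealI[OF ring_free_alg])
  interpret ring "free_alg :: 'n qpoly ring" by (rule ring_free_alg)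
  show "subgroup vanishing_ideal (add_monoid (free_alg :: 'n qpoly ring))"
  proof (rule add.subgroupI)
    fix p :: "'n qpoly" assume p: "p \<in> vanishing_ideal"
    have "\<ominus>\<^bsub>free_alg\<^esub> p = - p"
      by (rule minus_equality) simp_all
    with p show "\<ominus>\<^bsub>free_alg\<^esub> p \<in> vanishing_ideal"
      by (simp add: vanishing_ideal_def)
  next
    show "(vanishing_ideal :: 'n qpoly set) \<noteq> {}"
      unfolding vanishing_ideal_def by (auto intro: exI[of _ 0])
  qed (auto simp: vanishing_ideal_def)
qed (auto simp: vanishing_ideal_def)

text \<open>The involution of a quotient acts on cosets as sets; stability of \<open>J\<close> under
  \<open>s\<close> lets it be computed on representatives.\<close>

lemma image_a_r_coset:
  assumes "\<And>x y. x \<in> carrier R \<Longrightarrow> y \<in> carrier R \<Longrightarrow> s (x \<oplus>\<^bsub>R\<^esub> y) = s x \<oplus>\<^bsub>R\<^esub> s y"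
    and "J \<subseteq> carrier R" "x \<in> carrier R" "s ` J = J"
  shows "s ` (J +>\<^bsub>R\<^esub> x) = J +>\<^bsub>R\<^esub> s x"
proof -
  have "s ` (J +>\<^bsub>R\<^esub> x) = (\<lambda>j. s j \<oplus>\<^bsub>R\<^esub> s x) ` J"
    using assms(1-3) by (auto simp: a_r_coset_def' image_iff subset_iff)
  also have "\<dots> = (\<lambda>j. j \<oplus>\<^bsub>R\<^esub> s x) ` (s ` J)"
    by (simp add: image_image)
  also have "\<dots> = J +>\<^bsub>R\<^esub> s x"
    by (auto simp: assms(4) a_r_coset_def')
  finally show ?thesis .
qed

lemma star_A_proj_A: "star_A (proj_A p) = proj_A (qstar p)"
proof -
  have sub: "qstar ` vanishing_ideal \<subseteq> vanishing_ideal"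
    by (auto simp: vanishing_ideal_def)
  have "x \<in> qstar ` vanishing_ideal" if "x \<in> vanishing_ideal" for x :: "'a qpoly"
    using that sub by (intro image_eqI[of _ _ "qstar x"]) auto
  with sub have "qstar ` vanishing_ideal = (vanishing_ideal :: 'a qpoly set)" by blast
  then show ?thesis
    unfolding star_A_def proj_A_def by (intro image_a_r_coset) simp_all
qed

lemma carrier_alg_A: "carrier alg_A = range proj_A"
  by (auto simp: alg_A_def FactRing_def A_RCOSETS_def' proj_A_def)

lemma star_A_add: "star_A (X \<oplus>\<^bsub>alg_A\<^esub> Y) = star_A X \<oplus>\<^bsub>alg_A\<^esub> star_A Y"
  by (simp add: alg_A_def FactRing_def set_add_def' star_A_def image_UN)

lemma star_A_star_A: "star_A (star_A X) = X"
  by (simp add: star_A_def image_image)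

lemma ring_alg_A: "ring alg_A"
  unfolding alg_A_def by (rule ideal.quotient_is_ring[OF ideal_vanishing])

lemma ideal_ideal_J: "ideal (ideal_J l h) alg_A"
  and star_A_ideal_J: "star_A ` ideal_J l h = ideal_J l h"
  and h_mem_ideal_J: "j \<in> {1..l} \<Longrightarrow> proj_A (h j) \<in> ideal_J l h"
proof -
  let ?F = "{J. star_ideal star_A alg_A J \<and> (\<lambda>j. proj_A (h j)) ` {1..l} \<subseteq> J}"
  \<comment> \<open>Intersecting ideals gives an ideal once the family is nonempty; the whole ring
    is a member.\<close>
  have "carrier alg_A \<in> ?F"
    using ring.oneideal[OF ring_alg_A]
    by (auto simp: star_ideal_def carrier_alg_A star_A_proj_A)
  then show "ideal (ideal_J l h) alg_A"
    unfolding ideal_J_def gen_star_ideal_def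
    by (intro ring.i_Intersect[OF ring_alg_A]) (auto simp: star_ideal_def)
  have sub: "star_A ` ideal_J l h \<subseteq> ideal_J l h"
    unfolding ideal_J_def gen_star_ideal_def star_ideal_def by blast
  then have "x \<in> star_A ` ideal_J l h" if "x \<in> ideal_J l h" for x
    using that by (intro image_eqI[of _ _ "star_A x"]) (auto simp: star_A_star_A)
  with sub show "star_A ` ideal_J l h = ideal_J l h" by blast
  show "j \<in> {1..l} \<Longrightarrow> proj_A (h j) \<in> ideal_J l h"
    unfolding ideal_J_def gen_star_ideal_def by blast
qed

section \<open>The projection onto the quotient by the equations\<close>

lemma hat_ring_hom: "hat l h \<in> ring_hom free_alg (alg_Ah l h)"
proof -
  have "proj_A \<in> ring_hom free_alg alg_A"
    using ideal.rcos_ring_hom[OF ideal_vanishing] unfolding proj_A_def[abs_def] alg_A_def .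
  moreover have "(+>\<^bsub>alg_A\<^esub>) (ideal_J l h) \<in> ring_hom alg_A (alg_Ah l h)"
    using ideal.rcos_ring_hom[OF ideal_ideal_J] unfolding alg_Ah_def .
  ultimately have "(+>\<^bsub>alg_A\<^esub>) (ideal_J l h) \<circ> proj_A \<in> ring_hom free_alg (alg_Ah l h)"
    by (rule ring_hom_trans)
  then show ?thesis by (simp add: hat_def[abs_def] comp_def)
qed

lemma hat_closed: "hat l h p \<in> carrier (alg_Ah l h)"
  and hat_add: "hat l h (p + q) = hat l h p \<oplus>\<^bsub>alg_Ah l h\<^esub> hat l h q"
  and hat_mult: "hat l h (p * q) = hat l h p \<otimes>\<^bsub>alg_Ah l h\<^esub> hat l h q"
  using ring_hom_closed[OF hat_ring_hom] ring_hom_add[OF hat_ring_hom] ring_hom_mult[OF hat_ring_hom]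
  by (metis UNIV_I free_alg_simps(1,2,5))+

lemma ring_alg_Ah: "ring (alg_Ah l h)"
  unfolding alg_Ah_def by (rule ideal.quotient_is_ring[OF ideal_ideal_J])

lemma hat_0: "hat l h 0 = \<zero>\<^bsub>alg_Ah l h\<^esub>"
  using ring_hom_zero[OF hat_ring_hom ring_free_alg ring_alg_Ah, of l h] by simp

lemma hat_sum:
  assumes "finite S"
  shows "hat l h (sum f S) = (\<Oplus>\<^bsub>alg_Ah l h\<^esub>i\<in>S. hat l h (f i))"
proof -
  interpret ring "alg_Ah l h" by (rule ring_alg_Ah)
  show ?thesis using assms
    by (induction S rule: finite_induct) (simp_all add: hat_0 hat_add hat_closed)
qed

lemma star_Ah_hat: "star_Ah (hat l h p) = hat l h (qstar p)"
proof -
  have "ideal_J l h \<subseteq> carrier alg_A"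
    using ideal_ideal_J[of l h] by (meson additive_subgroup.a_subset ideal.axioms(1))
  then show ?thesis
    unfolding star_Ah_def hat_def star_A_proj_A[symmetric]
    by (intro image_a_r_coset star_A_add star_A_ideal_J) (auto simp: carrier_alg_A)
qed

text \<open>Lets identities be checked at quaternion points, where symmetric elements are real and
  commute with everything, although in the free algebra they need not.\<close>

lemma hat_cong:
  fixes p q :: "'n::finite qpoly"
  assumes "\<And>a. qeval a p = qeval a q"
  shows "hat l h p = hat l h q"
proof -
  have "p - q \<in> vanishing_ideal" using assms by (simp add: vanishing_ideal_def)
  then have "proj_A (p - q) = proj_A 0"
    using ring.a_rcos_zero[OF ring_free_alg ideal_vanishing, of "p - q"]
      ring.a_rcos_zero[OF ring_free_alg ideal_vanishing, of "0 :: 'n qpoly"]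
    by (simp add: proj_A_def vanishing_ideal_def)
  then have *: "hat l h (p - q) = hat l h 0" by (simp add: hat_def)
  interpret ring "alg_Ah l h" by (rule ring_alg_Ah)
  show ?thesis
    using hat_add[of l h "p - q" q] * by (simp add: hat_0 hat_closed)
qed

lemma hat_h:
  assumes "j \<in> {1..l}"
  shows "hat l h (h j) = \<zero>\<^bsub>alg_Ah l h\<^esub>"
  using ring.a_rcos_zero[OF ring_alg_A ideal_ideal_J h_mem_ideal_J[OF assms]]
  by (simp add: hat_def alg_Ah_def FactRing_def)

text \<open>In the quotient the terms in \<open>h j\<close> vanish and the symmetric
  \<open>g i\<close> become central, so half of \<open>\<sigma> i * g i + g i * \<sigma> i\<close>
  turns into a sum of sandwiches \<open>qstar q * g i * q\<close>.\<close>

lemma hat_quad_module: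
  assumes u: "u \<in> quad_module m g l h" and g: "\<forall>i\<in>{1..m}. g i \<in> Sym"
  shows "hat l h u \<in> quad_module_Ah m g l h"
proof -
  interpret Ah: ring "alg_Ah l h" by (rule ring_alg_Ah)
  obtain \<sigma> \<tau> \<nu> and N :: "nat \<Rightarrow> nat" where \<sigma>: "\<forall>i\<in>{0..m}. \<sigma> i \<in> SOS"
    and u: "u = \<sigma> 0 + qconst (1/2) * (\<Sum>i\<in>{1..m}. \<sigma> i * g i + g i * \<sigma> i)
        + (\<Sum>j\<in>{1..l}. \<Sum>\<alpha><N j. \<tau> j \<alpha> * h j * \<nu> j \<alpha>
             + qstar (\<nu> j \<alpha>) * qstar (h j) * qstar (\<tau> j \<alpha>))" (is "_ = _ + ?ideal_part")
    using assms unfolding quad_module_def by blast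
  \<comment> \<open>The \<open>h j\<close> need not be symmetric, so their adjoints are treated
    separately, by applying the involution of the quotient to zero.\<close>
  have "hat l h (qstar (h j)) = \<zero>\<^bsub>alg_Ah l h\<^esub>" if "j \<in> {1..l}" for j
    using star_Ah_hat[of l h "h j"] star_Ah_hat[of l h 0] hat_h[OF that, of h] hat_0[of l h] by simp
  then have "hat l h ?ideal_part = (\<Oplus>\<^bsub>alg_Ah l h\<^esub>j\<in>{1..l}. \<zero>\<^bsub>alg_Ah l h\<^esub>)"
    unfolding hat_sum[OF finite_atLeastAtMost]
    by (intro Ah.finsum_cong) (auto simp: hat_sum hat_add hat_mult hat_h hat_closed simp_implies_def)
  then have ideal_part: "hat l h ?ideal_part = \<zero>\<^bsub>alg_Ah l h\<^esub>"
    by simp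
  have "\<forall>i\<in>{0..m}. \<exists>q :: nat \<Rightarrow> _. \<exists>k :: nat. \<sigma> i = (\<Sum>s<k. qstar (q s) * q s)"
    using \<sigma> unfolding SOS_def by blast
  then obtain q and K :: "nat \<Rightarrow> nat" where q: "\<And>i. i \<in> {0..m} \<Longrightarrow> \<sigma> i = (\<Sum>s<K i. qstar (q i s) * q i s)"
    by metis
  have "hat l h (\<sigma> 0 + qconst (1/2) * (\<Sum>i\<in>{1..m}. \<sigma> i * g i + g i * \<sigma> i)) =
      hat l h ((\<Sum>s<K 0. qstar (q 0 s) * q 0 s) + (\<Sum>i\<in>{1..m}. \<Sum>s<K i. qstar (q i s) * g i * q i s))"
  proof (rule hat_cong)
    fix a
    have comm: "qeval a (g i) * x = x * qeval a (g i)" if "i \<in> {1..m}" for i x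
      using qeval_Sym[of "g i" a] g that by (metis of_real_quat_commute)
    have half: "of_real (1 / 2) * (x + x) = (x :: quat)" for x
      unfolding scaleR_conv_of_real[symmetric] by (rule scaleR_half_double)
    have "qeval a (\<sigma> i * g i + g i * \<sigma> i) =
        qeval a (\<Sum>s<K i. qstar (q i s) * g i * q i s) + qeval a (\<Sum>s<K i. qstar (q i s) * g i * q i s)"
      if i: "i \<in> {1..m}" for i
      using i q[of i] comm[OF i] by (simp add: sum_distrib_left sum_distrib_right mult.assoc)
    then have "qeval a (\<Sum>i\<in>{1..m}. \<sigma> i * g i + g i * \<sigma> i) =
        (\<Sum>i\<in>{1..m}. qeval a (\<Sum>s<K i. qstar (q i s) * g i * q i s)) +
        (\<Sum>i\<in>{1..m}. qeval a (\<Sum>s<K i. qstar (q i s) * g i * q i s))"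
      unfolding qeval_sum[of a _ "{1..m}"] sum.distrib[symmetric] by (intro sum.cong) auto
    then show "qeval a (\<sigma> 0 + qconst (1/2) * (\<Sum>i\<in>{1..m}. \<sigma> i * g i + g i * \<sigma> i)) =
      qeval a ((\<Sum>s<K 0. qstar (q 0 s) * q 0 s) + (\<Sum>i\<in>{1..m}. \<Sum>s<K i. qstar (q i s) * g i * q i s))"
      unfolding qeval_add[of a "\<sigma> 0"] qeval_add[of a "\<Sum>s<K 0. _ s"] qeval_mult[of a "qconst _"] qeval_qconst
      by (simp only: half q[of 0] qeval_sum[of a _ "{1..m}"]) (simp add: q[of 0])
  qed
  then have "hat l h u = hat l h ((\<Sum>s<K 0. qstar (q 0 s) * q 0 s) +
      (\<Sum>i\<in>{1..m}. \<Sum>s<K i. qstar (q i s) * g i * q i s))"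
    unfolding u hat_add[of l h _ ?ideal_part] ideal_part by (simp add: hat_closed)
  also have "\<dots> = (\<Oplus>\<^bsub>alg_Ah l h\<^esub>\<alpha>\<in>{..<K 0}. star_Ah (hat l h (q 0 \<alpha>)) \<otimes>\<^bsub>alg_Ah l h\<^esub> hat l h (q 0 \<alpha>))
        \<oplus>\<^bsub>alg_Ah l h\<^esub>
      (\<Oplus>\<^bsub>alg_Ah l h\<^esub>i\<in>{1..m}. \<Oplus>\<^bsub>alg_Ah l h\<^esub>\<alpha>\<in>{..<K i}.
         star_Ah (hat l h (q i \<alpha>)) \<otimes>\<^bsub>alg_Ah l h\<^esub> hat l h (g i) \<otimes>\<^bsub>alg_Ah l h\<^esub> hat l h (q i \<alpha>))"
    by (simp only: hat_add hat_sum finite_atLeastAtMost finite_lessThan star_Ah_hat hat_mult)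
  finally show ?thesis
    unfolding quad_module_Ah_def
    by (intro CollectI exI[of _ K] exI[of _ "\<lambda>i \<alpha>. hat l h (q i \<alpha>)"]) (simp add: hat_closed)
qed

theorem theorem4p7:
  fixes f :: "'n::finite qpoly"
    and m l :: nat
    and g h :: "nat \<Rightarrow> 'n qpoly"
  assumes "f \<in> Sym"
    and "\<forall>i\<in>{1..m}. g i \<in> Sym"
    and "archimedean (quad_module m g l h)"
    and "\<forall>a\<in>semialg_set m g l h. 0 < qeval a f"
  shows "hat l h f \<in> quad_module_Ah m g l h
    \<and> (\<exists>u\<in>quad_module m g l h. \<exists>v\<in>Sym \<inter> vanishing_ideal. f = u + v)"
proof -
  obtain u v where uv: "u \<in> quad_module m g l h" "v \<in> Sym \<inter> vanishing_ideal" "f = u + v"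
    using positivstellensatz_free[OF assms] by blast
  then have "hat l h f = hat l h u"
    by (intro hat_cong) (simp add: vanishing_ideal_def)
  then show ?thesis using uv hat_quad_module[OF uv(1) assms(2)] by auto
qed

end
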